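(* Let $n \geq 1$ and let $\nu$ be a probability measure on $\mathbb{R}^n$ having a continuous and positive density $f$ with respect to the standard Gaussian measure $\gamma_n$, with $f\varphi_n \in \mathcal{B}_n$. Then $$ \delta_{Tal}(f) := 2 H(\nu|\gamma_n) - W_2^2(\nu,\gamma_n) \;\geq\; \frac{1}{2}\, d_n(f\varphi_n,\varphi_n)^2 . $$
   Context: Gaussian measure. $\varphi_n(x) := (2\pi)^{-n/2} e^{-|x|^2/2}$, $x \in \mathbb{R}^n$, with $|\cdot|$ the Euclidean norm, and $\gamma_n(dx) = \varphi_n(x)\,dx$ is the standard Gaussian measure on $\mathbb{R}^n$. Relative entropy and Wasserstein distance. $H(\nu|\gamma_n) := \int_{\mathbb{R}^n} \log \frac{d\nu}{d\gamma_n}\, d\nu$ if $\nu \ll \gamma_n$, and $H(\nu|\gamma_n) := +\infty$ otherwise. The Kantorovich-Wasserstein distance is $$ W_2(\nu,\mu) := \inf_{\pi} \left( \iint |x-y|^2\, \pi(dx,dy) \right)^{1/2}, $$ the infimum running over all couplings $\pi$ on $\mathbb{R}^n\times\mathbb{R}^n$ with first marginal $\nu$ and second marginal $\mu$. When $H(\nu|\gamma_n)=+\infty$, the inequality is understood in the form $W_2^2(\nu,\gamma_n) + \frac12 d_n(f\varphi_n,\varphi_n)^2 \leq 2H(\nu|\gamma_n)$ in $[0,+\infty]$. The one-dimensional distance $d$. Let $\mathcal{B}$ be the set of continuous functions $u \colon \mathbb{R} \to (0,+\infty)$ with $\int_{\mathbb{R}} u(x)\,dx = 1$. For $u, v \in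 \mathcal{B}$, let $\mu(dx) = u(x)dx$, $\rho(dx) = v(x)dx$, $F_\mu(x) := \int_{-\infty}^x u(y)\,dy$, $F_\rho(x) := \int_{-\infty}^x v(y)\,dy$, and let $T := F_\rho^{-1} \circ F_\mu$ (the increasing map pushing $\mu$ forward onto $\rho$). Define $$ d(u,v) := \int_{\mathbb{R}} \frac{|1-T'|}{\max(1,T')}\, d\mu . $$ The $n$-dimensional distance $d_n$. For a direction $\xi \in \mathbb{S}^{n-1}$ (the unit sphere of $\mathbb{R}^n$), let $H_\xi := \{ y \in \mathbb{R}^n : \langle \xi, y\rangle = 0\}$, and write each $x\in\mathbb{R}^n$ as $x = x' + t\xi$ with $x' \in H_\xi$, $t \in \mathbb{R}$. For an integrable $g \colon \mathbb{R}^n \to \mathbb{R}$ set $$ g_\xi(t) := \int_{H_\xi} g(x' + t\xi)\, d\mathcal{H}^{n-1}(x'), \quad t \in \mathbb{R}, $$ where $\mathcal{H}^{n-1}$ is the $(n-1)$-dimensional Hausdorff measure on $H_\xi$. Let $$ \mathcal{B}_n := \{ g \in L^1(\mathbb{R}^n, \mathbb{R}_+) : x\,g(x) \in L^1(\mathbb{R}^n,\mathbb{R}^n),\ g_\xi \in \mathcal{B} \text{ for all } \xi \in \mathbb{S}^{n-1} \}, $$ and for $g, h \in \mathcal{B}_n$ define $$ d_n(g,h) := \sup_{\xi \in \mathbb{S}^{n-1}} d(g_\xi, h_\xi). $$ *)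

theory Defs
  imports "HOL-Probability.Probability"
begin

definition gauss_density :: "real ^ 'n \<Rightarrow> real" where
  "gauss_density x = (2 * pi) powr (- real CARD('n) / 2) * exp (- (norm x)\<^sup>2 / 2)"

definition gauss_measure :: "(real ^ 'n) measure" where
  "gauss_measure = density lborel (\<lambda>x. ennreal (gauss_density x))"


(* KL_divergence b M N is the Bochner integral of log_b (dN/dM) with respect to N, which is 0 when
   the integrand is not integrable.  For probability measures N << M the negative part of
   log (dN/dM) is always N-integrable, so in the non-integrable case the integral is +infinity.
   With the ereal convention infinity - infinity = infinity, a bound r <= 2 H - W^2 with real r >= 0
   is equivalent to W^2 + r <= 2 H in [0, infinity], for finite as well as for infinite H. *)
definition rel_entropy :: "'a measure \<Rightarrow> 'a measure \<Rightarrow> ereal" where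
  "rel_entropy N M =
     (if absolutely_continuous M N \<and> integrable N (entropy_density (exp 1) M N)
      then ereal (KL_divergence (exp 1) M N) else \<infinity>)"

definition couplings ::
  "'a::topological_space measure \<Rightarrow> 'a measure \<Rightarrow> ('a \<times> 'a) measure set" where
  "couplings N M = {P. sets P = sets borel \<and> distr P borel fst = N \<and> distr P borel snd = M}"

definition ennreal_sqrt :: "ennreal \<Rightarrow> ennreal" where
  "ennreal_sqrt a = (if a = \<infinity> then \<infinity> else ennreal (sqrt (enn2real a)))"

definition wasserstein2 ::
  "'a::real_normed_vector measure \<Rightarrow> 'a measure \<Rightarrow> ennreal" where
  "wasserstein2 N M =
     (INF P\<in>couplings N M. ennreal_sqrt (\<integral>\<^sup>+ (x, y). ennreal ((norm (x - y))\<^sup>2) \<partial>P))"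


definition class_B :: "(real \<Rightarrow> real) set" where
  "class_B = {u. continuous_on UNIV u \<and> (\<forall>x. 0 < u x) \<and> has_bochner_integral lborel u 1}"

definition cdf_of :: "(real \<Rightarrow> real) \<Rightarrow> real \<Rightarrow> real" where
  "cdf_of u x = (LINT y:{..x}|lborel. u y)"

(* For u and v in class_B, both cdfs are strictly increasing bijections onto the open interval
   (0,1), so the inverse is only evaluated inside the range of cdf_of v. *)
definition monotone_transport :: "(real \<Rightarrow> real) \<Rightarrow> (real \<Rightarrow> real) \<Rightarrow> real \<Rightarrow> real" where
  "monotone_transport u v = inv (cdf_of v) \<circ> cdf_of u"

definition dist1 :: "(real \<Rightarrow> real) \<Rightarrow> (real \<Rightarrow> real) \<Rightarrow> real" where
  "dist1 u v =
     (LINT x|density lborel (\<lambda>x. ennreal (u x)).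
        \<bar>1 - deriv (monotone_transport u v) x\<bar> / max 1 (deriv (monotone_transport u v) x))"


(* k-dimensional Hausdorff measure for a natural number k, normalised so that it agrees with
   Lebesgue measure on k-dimensional subspaces.  A nonempty set of diameter 0 has weight 1 if k = 0
   (0 ^ 0 = 1), so that the 0-dimensional measure is counting measure; the empty set has weight 0.
   Boundedness is required of covering sets because diameter is unspecified on unbounded sets. *)
definition hausdorff_weight :: "nat \<Rightarrow> 'a::metric_space set \<Rightarrow> ennreal" where
  "hausdorff_weight k S =
     (if S = {} then 0 else ennreal (unit_ball_vol (real k) * (diameter S / 2) ^ k))"

definition hausdorff_outer :: "nat \<Rightarrow> 'a::metric_space set \<Rightarrow> ennreal" where
  "hausdorff_outer k A =
     (SUP \<delta>\<in>{0::real<..}.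
        INF U\<in>{U :: nat \<Rightarrow> 'a set. A \<subseteq> (\<Union>i. U i) \<and> (\<forall>i. bounded (U i) \<and> diameter (U i) \<le> \<delta>)}.
          (\<Sum>i. hausdorff_weight k (U i)))"

(* hausdorff_outer k is a metric outer measure, hence countably additive on the Borel sets, so
   measure_of does not collapse to the null measure here. *)
definition hausdorff_measure :: "nat \<Rightarrow> 'a::metric_space measure" where
  "hausdorff_measure k = measure_of UNIV (sets borel) (hausdorff_outer k)"

definition orth_hyperplane :: "real ^ 'n \<Rightarrow> (real ^ 'n) set" where
  "orth_hyperplane \<xi> = {y. \<xi> \<bullet> y = 0}"

definition dir_marginal :: "(real ^ 'n \<Rightarrow> real) \<Rightarrow> real ^ 'n \<Rightarrow> real \<Rightarrow> real" where
  "dir_marginal g \<xi> t =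
     (LINT x:orth_hyperplane \<xi>|hausdorff_measure (CARD('n) - 1). g (x + t *\<^sub>R \<xi>))"

definition class_Bn :: "(real ^ 'n \<Rightarrow> real) set" where
  "class_Bn =
     {g. integrable lborel g \<and> (\<forall>x. 0 \<le> g x) \<and> integrable lborel (\<lambda>x. g x *\<^sub>R x) \<and>
         (\<forall>\<xi>\<in>sphere 0 1. dir_marginal g \<xi> \<in> class_B)}"

(* The supremum is over a nonempty set of reals in [0,1]: the integrand of dist1 lies in [0,1]. *)
definition distn :: "(real ^ 'n \<Rightarrow> real) \<Rightarrow> (real ^ 'n \<Rightarrow> real) \<Rightarrow> real" where
  "distn g h = (SUP \<xi>\<in>sphere 0 1. dist1 (dir_marginal g \<xi>) (dir_marginal h \<xi>))"

end

theory Submission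
  imports Defs
begin

text \<open>Let \<open>\<gamma>\<close> be the standard Gaussian measure and \<open>\<nu> = f \<gamma>\<close>. Any map \<open>S\<close> that pushes \<open>\<gamma>\<close> forward
  to \<open>\<nu>\<close> bounds \<open>W\<^sub>2\<^sup>2\<close> by \<open>\<integral> |S x - x|\<^sup>2 d\<gamma>\<close>, so it suffices to find, for each direction \<open>\<xi>\<close>, a map
  whose cost stays below \<open>2 H\<close> by at least the square of the one-dimensional distance in direction \<open>\<xi>\<close>.

  On the line take the increasing map \<open>S\<close> from \<open>\<gamma>\<close> to \<open>u dx\<close>. The Monge--Ampere equation
  \<open>u (S y) S' y = \<phi> y\<close> expresses \<open>ln f (S y)\<close> through \<open>ln (S' y)\<close>, and Gaussian integration by parts
  turns \<open>\<integral> y S y\<close> into \<open>\<integral> S'\<close>. This gives the identity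
  \<open>2 H - \<integral> (S y - y)\<^sup>2 d\<gamma> = 2 \<integral> (S' - 1 - ln S') d\<gamma>\<close>, whose upper bound on the cost is
  \<open>talagrand_line\<close>. The integrand on the right dominates half the square of the integrand of the
  distance, and Cauchy--Schwarz makes the right-hand side at least the square of the distance
  (\<open>dist1_std_normal_le\<close>).

  In higher dimension choose an orthonormal basis that contains \<open>\<xi>\<close> and build Knothe's triangular map
  one coordinate at a time, \<open>\<xi>\<close> first (\<open>transport_bound_Times_gauss\<close>, \<open>transport_bound_gauss_product\<close>).
  By the chain rule for entropy the deficits of the one-dimensional maps add up. All of them are
  nonnegative, and the first one is the deficit of the marginal in direction \<open>\<xi>\<close>. The total deficit is
  therefore at least the square of the distance, hence at least half of it.

  The conditional densities of the later coordinates are only measurable. For this reason the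
  derivative of a transport map is replaced in the cost estimate by its slope \<open>u / v (S)\<close>, which integrates to
  the increments of \<open>S\<close> by the push-forward property alone (\<open>nn_integral_transport_slope\<close>).

  It remains to know that the hyperplane integrals \<open>dir_marginal\<close> are densities of one-dimensional
  projections. The Hausdorff measure on the hyperplane, times Lebesgue measure in direction \<open>\<xi>\<close>, is
  translation invariant and hence a multiple of Lebesgue measure. The factor is 1 because one
  probability density, \<open>f \<phi>\<close>, has marginals of mass 1 (\<open>hyperplane_Fubini\<close>).\<close>

section \<open>Monotone transport between positive densities on the line\<close>

definition pos_density :: "(real \<Rightarrow> real) \<Rightarrow> bool" where
  "pos_density u \<longleftrightarrow> u \<in> borel_measurable borel \<and> (\<forall>x. 0 < u x) \<and> (\<integral>\<^sup>+x. ennreal (u x) \<partial>lborel) = 1"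

lemma pos_density_measurable: "pos_density u \<Longrightarrow> u \<in> borel_measurable borel"
  and pos_density_pos: "pos_density u \<Longrightarrow> 0 < u x"
  and pos_density_nn_integral: "pos_density u \<Longrightarrow> (\<integral>\<^sup>+x. ennreal (u x) \<partial>lborel) = 1"
  by (auto simp: pos_density_def)

lemma pos_density_std_normal: "pos_density std_normal_density"
proof -
  have "(\<integral>\<^sup>+x. ennreal (std_normal_density x) \<partial>lborel) = ennreal (\<integral>x. std_normal_density x \<partial>lborel)"
    by (rule nn_integral_eq_integral) (auto intro!: integrable_normal_density)
  then show ?thesis
    by (auto simp: pos_density_def normal_density_pos)
qed

lemma class_B_pos_density:
  assumes "u \<in> class_B" shows "pos_density u"
proof -
  have c: "continuous_on UNIV u" and p: "\<And>x. 0 < u x" and i: "has_bochner_integral lborel u 1"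
    using assms by (auto simp: class_B_def)
  have "(\<integral>\<^sup>+x. ennreal (u x) \<partial>lborel) = ennreal (integral\<^sup>L lborel u)"
    using i p by (intro nn_integral_eq_integral) (auto simp: has_bochner_integral_iff less_imp_le)
  then show ?thesis
    using c p i by (auto simp: pos_density_def has_bochner_integral_iff borel_measurable_continuous_onI)
qed

lemma pos_density_real_distribution:
  assumes "pos_density u" shows "real_distribution (density lborel u)"
proof -
  interpret prob_space "density lborel u"
    using assms by (intro prob_spaceI) (auto simp: emeasure_density pos_density_def)
  show ?thesis by standard auto
qed

lemma cdf_of_eq_cdf:
  assumes u: "pos_density u" shows "cdf_of u x = cdf (density lborel u) x"
proof -
  note [measurable] = pos_density_measurable[OF u]
  have "emeasure (density lborel u) {..x} = (\<integral>\<^sup>+y. ennreal (indicator {..x} y * u y) \<partial>lborel)"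
    by (auto simp: emeasure_density intro!: nn_integral_cong split: split_indicator)
  then have "measure (density lborel u) {..x} = (\<integral>y. indicator {..x} y * u y \<partial>lborel)"
    using pos_density_pos[OF u] by (subst integral_eq_nn_integral)
      (auto simp: measure_def less_imp_le)
  then show ?thesis
    by (simp add: cdf_of_def cdf_def set_lebesgue_integral_def)
qed

context
  fixes u :: "real \<Rightarrow> real"
  assumes u: "pos_density u"
begin

interpretation real_distribution "density lborel u"
  by (rule pos_density_real_distribution[OF u])

lemma cdf_of_strict_mono: "strict_mono (cdf_of u)"
proof (rule strict_monoI)
  fix a b :: real assume "a < b"
  note [measurable] = pos_density_measurable[OF u]
  have "emeasure (density lborel u) {a<..b} \<noteq> 0"
  proof
    assume "emeasure (density lborel u) {a<..b} = 0"
    then have "AE x in lborel. x \<in> {a<..b} \<longrightarrow> ennreal (u x) = 0"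
      by (auto simp: emeasure_density nn_integral_0_iff_AE indicator_def)
    then have "AE x in lborel. x \<notin> {a<..b}"
      by (rule AE_mp) (use pos_density_pos[OF u] in \<open>auto simp: ennreal_eq_0_iff simp flip: not_less\<close>)
    then have "emeasure lborel {a<..b} = 0"
      by (subst (asm) AE_iff_measurable[of "{a<..b}"]) auto
    then show False using \<open>a < b\<close> by simp
  qed
  then have "measure (density lborel u) {a<..b} > 0"
    by (simp add: emeasure_eq_measure zero_less_measure_iff)
  with cdf_diff_eq[OF \<open>a < b\<close>] show "cdf_of u a < cdf_of u b"
    by (simp add: cdf_of_eq_cdf[OF u])
qed

lemma isCont_cdf_of: "isCont (cdf_of u) x"
proof -
  note [measurable] = pos_density_measurable[OF u]
  have "AE y in lborel. y \<noteq> x" by (rule AE_lborel_singleton)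
  then have "emeasure (density lborel u) {x} = 0"
    by (auto simp: emeasure_density nn_integral_0_iff_AE indicator_def elim!: eventually_mono)
  then show ?thesis
    using isCont_cdf[of x] by (simp add: measure_def cdf_of_eq_cdf[OF u, abs_def])
qed

lemma range_cdf_of: "range (cdf_of u) = {0<..<1}"
proof (intro set_eqI iffI)
  have bounds: "0 \<le> cdf_of u x" "cdf_of u x \<le> 1" for x
    using cdf_nonneg cdf_bounded_prob by (auto simp: cdf_of_eq_cdf[OF u])
  fix p assume "p \<in> range (cdf_of u)"
  then obtain x where "p = cdf_of u x" by auto
  moreover have "cdf_of u (x - 1) < cdf_of u x" "cdf_of u x < cdf_of u (x + 1)"
    using cdf_of_strict_mono by (auto simp: strict_mono_def)
  ultimately show "p \<in> {0<..<1}" using bounds[of "x - 1"] bounds[of "x + 1"] by auto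
next
  fix p :: real assume p: "p \<in> {0<..<1}"
  have "eventually (\<lambda>x. cdf_of u x > p) at_top" "eventually (\<lambda>x. cdf_of u x < p) at_bot"
    using order_tendstoD(1)[OF cdf_lim_at_top_prob] order_tendstoD(2)[OF cdf_lim_at_bot] p
    by (auto simp: cdf_of_eq_cdf[OF u])
  then obtain a b where "cdf_of u b > p" "cdf_of u a < p"
    by (auto simp: eventually_at_top_linorder eventually_at_bot_linorder)
  moreover from this have "a \<le> b"
    using strict_mono_less[OF cdf_of_strict_mono, of a b] by auto
  ultimately obtain x where "cdf_of u x = p"
    using IVT[of "cdf_of u" a p b] isCont_cdf_of by force
  then show "p \<in> range (cdf_of u)" by auto
qed

end

text \<open>Since both distribution functions map the line bijectively onto the open unit interval,
  the inverse in the transport map can be cancelled.\<close>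

lemma cdf_of_monotone_transport:
  assumes u: "pos_density u" and v: "pos_density v"
  shows "cdf_of v (monotone_transport u v x) = cdf_of u x"
  unfolding monotone_transport_def comp_def
  by (rule f_inv_into_f) (simp add: range_cdf_of[OF v] flip: range_cdf_of[OF u])

lemma monotone_transport_le_iff:
  assumes u: "pos_density u" and v: "pos_density v"
  shows "monotone_transport u v x \<le> s \<longleftrightarrow> cdf_of u x \<le> cdf_of v s"
  using strict_mono_less_eq[OF cdf_of_strict_mono[OF v], of "monotone_transport u v x" s]
  by (simp add: cdf_of_monotone_transport[OF u v])

lemma monotone_transport_inverse:
  assumes u: "pos_density u" and v: "pos_density v"
  shows "monotone_transport v u (monotone_transport u v x) = x"
  using strict_mono_eq[OF cdf_of_strict_mono[OF u], of "monotone_transport v u (monotone_transport u v x)" x]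
  by (simp add: cdf_of_monotone_transport[OF u v] cdf_of_monotone_transport[OF v u])

lemma strict_mono_monotone_transport:
  assumes u: "pos_density u" and v: "pos_density v"
  shows "strict_mono (monotone_transport u v)"
proof (rule strict_monoI)
  fix x y :: real assume "x < y"
  then have "cdf_of u x < cdf_of u y" using cdf_of_strict_mono[OF u] by (simp add: strict_mono_def)
  then show "monotone_transport u v x < monotone_transport u v y"
    using strict_mono_less[OF cdf_of_strict_mono[OF v], of "monotone_transport u v x" "monotone_transport u v y"]
    by (simp add: cdf_of_monotone_transport[OF u v])
qed

lemma measurable_monotone_transport:
  assumes u: "pos_density u" and v: "pos_density v"
  shows "monotone_transport u v \<in> borel_measurable borel"
  by (intro borel_measurable_mono strict_mono_mono strict_mono_monotone_transport u v)

lemma distr_monotone_transport: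
  assumes u: "pos_density u" and v: "pos_density v"
  shows "distr (density lborel u) borel (monotone_transport u v) = density lborel v"
proof (rule cdf_unique)
  note [measurable] = measurable_monotone_transport[OF u v]
  interpret U: real_distribution "density lborel u" by (rule pos_density_real_distribution[OF u])
  show "real_distribution (density lborel v)" by (rule pos_density_real_distribution[OF v])
  show "real_distribution (distr (density lborel u) borel (monotone_transport u v))"
    by (intro U.real_distribution_distr) simp
  show "cdf (distr (density lborel u) borel (monotone_transport u v)) = cdf (density lborel v)"
  proof
    fix s
    let ?x = "monotone_transport v u s"
    have "cdf (distr (density lborel u) borel (monotone_transport u v)) s
        = measure (density lborel u) {x. monotone_transport u v x \<le> s}"
      by (simp add: cdf_def measure_distr vimage_def)
    also have "{x. monotone_transport u v x \<le> s} = {..?x}"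
      using strict_mono_less_eq[OF cdf_of_strict_mono[OF u], of _ ?x]
      by (auto simp: monotone_transport_le_iff[OF u v] cdf_of_monotone_transport[OF v u])
    also have "measure (density lborel u) \<dots> = cdf_of u ?x"
      by (simp add: cdf_of_eq_cdf[OF u] cdf_def)
    also have "\<dots> = cdf (density lborel v) s"
      by (simp add: cdf_of_monotone_transport[OF v u] cdf_of_eq_cdf[OF v])
    finally show "cdf (distr (density lborel u) borel (monotone_transport u v)) s = cdf (density lborel v) s" .
  qed
qed

lemma nn_integral_monotone_transport:
  assumes u: "pos_density u" and v: "pos_density v" and [measurable]: "g \<in> borel_measurable borel"
  shows "(\<integral>\<^sup>+y. g (monotone_transport u v y) \<partial>density lborel u) = (\<integral>\<^sup>+x. g x \<partial>density lborel v)"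
  using measurable_monotone_transport[OF u v]
  by (simp add: nn_integral_distr flip: distr_monotone_transport[OF u v])

text \<open>This is the derivative of the transport map as prescribed by the Monge--Ampere equation
  \<open>v (S y) S' y = u y\<close>.\<close>

definition transport_slope :: "(real \<Rightarrow> real) \<Rightarrow> (real \<Rightarrow> real) \<Rightarrow> real \<Rightarrow> real" where
  "transport_slope u v y = u y / v (monotone_transport u v y)"

lemma transport_slope_pos:
  "pos_density u \<Longrightarrow> pos_density v \<Longrightarrow> 0 < transport_slope u v y"
  by (simp add: transport_slope_def pos_density_pos)

lemma measurable_transport_slope:
  assumes u: "pos_density u" and v: "pos_density v"
  shows "transport_slope u v \<in> borel_measurable borel"
  unfolding transport_slope_def[abs_def]
  using pos_density_measurable[OF u] pos_density_measurable[OF v] measurable_monotone_transport[OF u v]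
  by measurable

text \<open>The push-forward property turns the integral of \<open>u / v (S)\<close> over an interval into the integral
  of \<open>v / v = 1\<close> over the image interval. Thus the transport map is the integral of its slope even if
  the densities are merely measurable.\<close>

lemma nn_integral_transport_slope:
  assumes u: "pos_density u" and v: "pos_density v" and "a \<le> b"
  shows "(\<integral>\<^sup>+y. ennreal (transport_slope u v y) * indicator {a<..b} y \<partial>lborel)
       = ennreal (monotone_transport u v b - monotone_transport u v a)"
proof -
  let ?S = "monotone_transport u v"
  note [measurable] = pos_density_measurable[OF u] pos_density_measurable[OF v]
  have less: "?S x < ?S y \<longleftrightarrow> x < y" and le: "?S x \<le> ?S y \<longleftrightarrow> x \<le> y" for x y
    using strict_mono_monotone_transport[OF u v] by (auto simp: strict_mono_less strict_mono_less_eq)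
  have "(\<integral>\<^sup>+y. ennreal (transport_slope u v y) * indicator {a<..b} y \<partial>lborel)
     = (\<integral>\<^sup>+y. ennreal (u y) * (ennreal (1 / v (?S y)) * indicator {?S a<..?S b} (?S y)) \<partial>lborel)"
    using pos_density_pos[OF u] pos_density_pos[OF v]
    by (intro nn_integral_cong)
      (auto simp: transport_slope_def less le ennreal_mult[symmetric] less_imp_le split: split_indicator)
  also have "\<dots> = (\<integral>\<^sup>+y. ennreal (1 / v (?S y)) * indicator {?S a<..?S b} (?S y) \<partial>density lborel u)"
    using measurable_monotone_transport[OF u v] by (subst nn_integral_density) auto
  also have "\<dots> = (\<integral>\<^sup>+x. ennreal (1 / v x) * indicator {?S a<..?S b} x \<partial>density lborel v)"
    by (rule nn_integral_monotone_transport[OF u v]) simp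
  also have "\<dots> = (\<integral>\<^sup>+x. ennreal (v x) * (ennreal (1 / v x) * indicator {?S a<..?S b} x) \<partial>lborel)"
    by (subst nn_integral_density) auto
  also have "\<dots> = (\<integral>\<^sup>+x. indicator {?S a<..?S b} x \<partial>lborel)"
    using pos_density_pos[OF v] pos_density_pos[OF v, THEN less_imp_neq, THEN not_sym]
    by (intro nn_integral_cong)
      (auto simp: ennreal_mult[symmetric] less_imp_le split: split_indicator)
  also have "\<dots> = ennreal (?S b - ?S a)"
    using le \<open>a \<le> b\<close> by simp
  finally show ?thesis .
qed

section \<open>The one-dimensional transport identity\<close>

abbreviation gauss_line :: "real measure" where
  "gauss_line \<equiv> density lborel (\<lambda>x. ennreal (std_normal_density x))"

text \<open>The next two functions are the gaps between a convex function and its tangent at 1. For a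
  probability density the integral of \<open>entropy_gap\<close> is the relative entropy, written with a nonnegative
  integrand. The integral of \<open>log_gap\<close> over the slope of a transport map is half of its deficit.\<close>

definition entropy_gap :: "real \<Rightarrow> real" where
  "entropy_gap r = r * ln r - r + 1"

definition log_gap :: "real \<Rightarrow> real" where
  "log_gap w = w - 1 - ln w"

lemma log_gap_nonneg: "0 < w \<Longrightarrow> 0 \<le> log_gap w"
  using ln_le_minus_one[of w] by (simp add: log_gap_def)

lemma measurable_entropy_gap [measurable]: "entropy_gap \<in> borel_measurable borel"
  and measurable_log_gap [measurable]: "log_gap \<in> borel_measurable borel"
  unfolding entropy_gap_def[abs_def] log_gap_def[abs_def] by measurable

text \<open>Young's inequality for the convex function \<open>entropy_gap\<close> and its conjugate \<open>exp b - 1\<close>.\<close>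

lemma mult_le_entropy_gap:
  assumes "0 < a" shows "a * b \<le> entropy_gap a + exp b - 1"
proof -
  have "0 \<le> a * log_gap (exp b / a)"
    using assms by (intro mult_nonneg_nonneg log_gap_nonneg) auto
  also have "a * log_gap (exp b / a) = exp b - a - a * (b - ln a)"
    using assms by (simp add: log_gap_def ln_div field_simps)
  finally show ?thesis by (simp add: entropy_gap_def algebra_simps)
qed

lemma entropy_gap_nonneg: "0 < a \<Longrightarrow> 0 \<le> entropy_gap a"
  using mult_le_entropy_gap[of a 0] by simp

lemma prob_space_gauss_line: "prob_space gauss_line"
  by (rule prob_space_normal_density) simp

lemma std_normal_tail_mass:
  assumes "0 \<le> c"
  shows "(\<integral>\<^sup>+z. ennreal (z * std_normal_density z) * indicator {c..} z \<partial>lborel) = ennreal (std_normal_density c)"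
proof -
  have lim: "((\<lambda>x. - std_normal_density x) \<longlongrightarrow> 0) at_top"
    unfolding std_normal_density_def by real_asymp
  have "(\<integral>\<^sup>+z. ennreal (z * std_normal_density z) * indicator {c..} z \<partial>lborel)
      = ennreal (0 - (- std_normal_density c))"
  proof (rule nn_integral_FTC_atLeast[OF _ _ _ lim])
    fix x assume "c \<le> x"
    show "((\<lambda>x. - std_normal_density x) has_real_derivative x * std_normal_density x) (at x)"
      unfolding std_normal_density_def by (auto intro!: derivative_eq_intros simp: sqrt_divide_self_eq field_simps)
    show "0 \<le> x * std_normal_density x" using \<open>c \<le> x\<close> assms by simp
  qed simp
  then show ?thesis by simp
qed

text \<open>The Gaussian density is the tail integral of its own derivative, taken on the side of \<open>y\<close> that is
  away from the origin. The kernel says that \<open>y\<close> lies between \<open>0\<close> and \<open>z\<close>. Integrated in \<open>y\<close>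
  against a slope, it will produce an increment of the transport map.\<close>

lemma std_normal_density_eq_tail:
  "ennreal (std_normal_density y) =
    (\<integral>\<^sup>+z. ennreal (\<bar>z\<bar> * std_normal_density z) * (indicator {0<..z} y + indicator {z<..0} y) \<partial>lborel)"
proof (cases "0 < y")
  case True
  then have "(\<integral>\<^sup>+z. ennreal (\<bar>z\<bar> * std_normal_density z) * (indicator {0<..z} y + indicator {z<..0} y) \<partial>lborel)
     = (\<integral>\<^sup>+z. ennreal (z * std_normal_density z) * indicator {y..} z \<partial>lborel)"
    by (intro nn_integral_cong) (auto split: split_indicator)
  with True show ?thesis by (simp add: std_normal_tail_mass)
next
  case False
  let ?g = "\<lambda>z. ennreal (\<bar>z\<bar> * std_normal_density z) * (indicator {0<..z} y + indicator {z<..0} y)"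
  have [measurable]: "?g \<in> borel_measurable borel"
    unfolding indicator_def greaterThanAtMost_iff of_bool_def by measurable
  have "(\<integral>\<^sup>+z. ?g z \<partial>lborel) = (\<integral>\<^sup>+z. ?g (- z) \<partial>lborel)"
    using nn_integral_real_affine[of ?g "-1" 0] by simp
  also have "\<dots> = (\<integral>\<^sup>+z. ennreal (z * std_normal_density z) * indicator {- y..} z \<partial>lborel)"
  proof (rule nn_integral_cong_AE)
    show "AE z in lborel. ?g (- z) = ennreal (z * std_normal_density z) * indicator {- y..} z"
      using AE_lborel_singleton[of "- y"]
    proof eventually_elim
      case (elim z)
      with False show ?case by (auto split: split_indicator simp: std_normal_density_def)
    qed
  qed
  also have "\<dots> = ennreal (std_normal_density y)"
    using False by (subst std_normal_tail_mass) (auto simp: std_normal_density_def)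
  finally show ?thesis by simp
qed

text \<open>Gaussian integration by parts by means of Fubini: insert the tail formula for the density on the
  left and integrate the slope between \<open>0\<close> and \<open>z\<close> first. Subtracting \<open>S 0\<close> keeps the integrand on the
  right nonnegative.\<close>

lemma nn_integral_slope_gauss_line:
  assumes u: "pos_density u"
  defines "S \<equiv> monotone_transport std_normal_density u"
  shows "(\<integral>\<^sup>+y. ennreal (transport_slope std_normal_density u y) \<partial>gauss_line)
       = (\<integral>\<^sup>+z. ennreal (z * (S z - S 0)) \<partial>gauss_line)"
proof -
  note n = pos_density_std_normal
  let ?w = "\<lambda>y. ennreal (transport_slope std_normal_density u y)"
  let ?k = "\<lambda>(y::real) z. indicator {0<..z} y + indicator {z<..0} y :: ennreal"
  let ?t = "\<lambda>z. ennreal (\<bar>z\<bar> * std_normal_density z)"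
  note [measurable] = measurable_transport_slope[OF n u] measurable_monotone_transport[OF n u, folded S_def]
  have "(\<lambda>p. ?k (fst p) (snd p)) \<in> borel_measurable (borel \<Otimes>\<^sub>M borel)"
    unfolding indicator_def greaterThanAtMost_iff of_bool_def by measurable
  also have "borel_measurable (borel \<Otimes>\<^sub>M borel) = borel_measurable (lborel \<Otimes>\<^sub>M (lborel :: real measure))"
    by (intro measurable_cong_sets sets_pair_measure_cong) auto
  finally have [measurable]: "(\<lambda>p. ?k (fst p) (snd p)) \<in> borel_measurable (lborel \<Otimes>\<^sub>M lborel)" .
  have less: "S x < S y \<longleftrightarrow> x < y" and le: "S x \<le> S y \<longleftrightarrow> x \<le> y" for x y
    using strict_mono_monotone_transport[OF n u] by (auto simp: S_def strict_mono_less strict_mono_less_eq)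
  have "(\<integral>\<^sup>+y. ?w y \<partial>gauss_line) = (\<integral>\<^sup>+y. ?w y * ennreal (std_normal_density y) \<partial>lborel)"
    by (subst nn_integral_density) (auto simp: mult.commute)
  also have "\<dots> = (\<integral>\<^sup>+y. \<integral>\<^sup>+z. ?w y * (?t z * ?k y z) \<partial>lborel \<partial>lborel)"
  proof (rule nn_integral_cong)
    fix y
    have "(\<lambda>z. ?t z * ?k y z) \<in> borel_measurable lborel"
      unfolding indicator_def greaterThanAtMost_iff of_bool_def by measurable
    then show "?w y * ennreal (std_normal_density y) = (\<integral>\<^sup>+z. ?w y * (?t z * ?k y z) \<partial>lborel)"
      by (subst nn_integral_cmult) (simp_all add: std_normal_density_eq_tail[of y])
  qed
  also have "\<dots> = (\<integral>\<^sup>+z. \<integral>\<^sup>+y. ?w y * (?t z * ?k y z) \<partial>lborel \<partial>lborel)"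
    by (rule lborel_pair.Fubini'[symmetric]) (simp add: case_prod_beta')
  also have "\<dots> = (\<integral>\<^sup>+z. ?t z * ennreal \<bar>S z - S 0\<bar> \<partial>lborel)"
  proof (rule nn_integral_cong)
    fix z
    have [measurable]: "(\<lambda>y. ?k y z) \<in> borel_measurable lborel" by simp
    have "(\<integral>\<^sup>+y. ?w y * (?t z * ?k y z) \<partial>lborel) = (\<integral>\<^sup>+y. ?t z * (?w y * ?k y z) \<partial>lborel)"
      by (simp add: ac_simps)
    also have "\<dots> = ?t z * (\<integral>\<^sup>+y. ?w y * ?k y z \<partial>lborel)"
      by (rule nn_integral_cmult) simp
    also have "(\<integral>\<^sup>+y. ?w y * ?k y z \<partial>lborel) = ennreal \<bar>S z - S 0\<bar>"
    proof (cases "0 \<le> z")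
      case True
      then have "(\<integral>\<^sup>+y. ?w y * ?k y z \<partial>lborel) = (\<integral>\<^sup>+y. ?w y * indicator {0<..z} y \<partial>lborel)"
        by (intro nn_integral_cong) (auto split: split_indicator)
      then show ?thesis
        using True le[of 0 z] nn_integral_transport_slope[OF n u True] by (simp add: S_def)
    next
      case False
      then have "(\<integral>\<^sup>+y. ?w y * ?k y z \<partial>lborel) = (\<integral>\<^sup>+y. ?w y * indicator {z<..0} y \<partial>lborel)"
        by (intro nn_integral_cong) (auto split: split_indicator)
      then show ?thesis
        using False le[of z 0] nn_integral_transport_slope[OF n u, of z 0] by (simp add: S_def)
    qed
    finally show "(\<integral>\<^sup>+y. ?w y * (?t z * ?k y z) \<partial>lborel) = ?t z * ennreal \<bar>S z - S 0\<bar>" .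
  qed
  also have "\<dots> = (\<integral>\<^sup>+z. ennreal (std_normal_density z) * ennreal (z * (S z - S 0)) \<partial>lborel)"
  proof (rule nn_integral_cong)
    fix z
    have "0 \<le> z * (S z - S 0)"
      using le[of 0 z] le[of z 0] by (cases "0 \<le> z") (auto intro: mult_nonpos_nonpos)
    then have "\<bar>z\<bar> * \<bar>S z - S 0\<bar> = z * (S z - S 0)"
      by (simp flip: abs_mult)
    then have "ennreal \<bar>z\<bar> * ennreal \<bar>S z - S 0\<bar> = ennreal (z * (S z - S 0))"
      by (simp flip: ennreal_mult')
    then show "?t z * ennreal \<bar>S z - S 0\<bar> = ennreal (std_normal_density z) * ennreal (z * (S z - S 0))"
      by (simp add: ennreal_mult mult.assoc mult.left_commute[of "ennreal \<bar>z\<bar>"])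
  qed
  also have "\<dots> = (\<integral>\<^sup>+z. ennreal (z * (S z - S 0)) \<partial>gauss_line)"
    by (subst nn_integral_density) auto
  finally show ?thesis .
qed

lemma integrable_gauss_line_iff:
  "g \<in> borel_measurable borel \<Longrightarrow>
    integrable gauss_line g \<longleftrightarrow> integrable lborel (\<lambda>x. std_normal_density x * g x)"
  by (subst integrable_density) auto

lemma integral_gauss_line:
  "g \<in> borel_measurable borel \<Longrightarrow>
    integral\<^sup>L gauss_line g = (\<integral>x. std_normal_density x * g x \<partial>lborel)"
  by (subst integral_density) auto

lemma gauss_line_moments:
  "integrable gauss_line (\<lambda>x. x)" "(\<integral>x. x \<partial>gauss_line) = 0"
  "integrable gauss_line (\<lambda>x. x\<^sup>2)" "(\<integral>x. x\<^sup>2 \<partial>gauss_line) = 1"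
  using std_normal_moment_odd[of 0] std_normal_moment_even[of 1]
  by (auto simp: integrable_gauss_line_iff integral_gauss_line has_bochner_integral_iff power2_eq_square)

text \<open>Young's inequality with \<open>b = x\<^sup>2 / 4\<close> applies, because \<open>exp (x\<^sup>2 / 4)\<close> is integrable
  with respect to the Gaussian.\<close>

lemma entropy_finite_second_moment:
  assumes f[measurable]: "f \<in> borel_measurable borel" and pos: "\<And>x. 0 < f x"
    and int: "integrable gauss_line (\<lambda>x. entropy_gap (f x))"
  shows "integrable gauss_line (\<lambda>x. f x * x\<^sup>2)"
proof (rule Bochner_Integration.integrable_bound)
  have "integrable lborel (\<lambda>x. sqrt 2 * normal_density 0 (sqrt 2) x)"
    by (intro integrable_mult_right integrable_normal_density) simp
  also have "(\<lambda>x. sqrt 2 * normal_density 0 (sqrt 2) x) = (\<lambda>x. std_normal_density x * exp (x\<^sup>2 / 4))"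
    by (auto simp: fun_eq_iff normal_density_def real_sqrt_mult mult_exp_exp field_simps)
  finally have "integrable gauss_line (\<lambda>x. exp (x\<^sup>2 / 4))"
    by (simp add: integrable_gauss_line_iff)
  then show "integrable gauss_line (\<lambda>x. 4 * (entropy_gap (f x) + exp (x\<^sup>2 / 4)))"
    using int by auto
  show "AE x in gauss_line. norm (f x * x\<^sup>2) \<le> norm (4 * (entropy_gap (f x) + exp (x\<^sup>2 / 4)))"
  proof (rule AE_I2)
    fix x
    have "f x * (x\<^sup>2 / 4) \<le> entropy_gap (f x) + exp (x\<^sup>2 / 4)"
      using mult_le_entropy_gap[OF pos, of x "x\<^sup>2 / 4"] by simp
    then show "norm (f x * x\<^sup>2) \<le> norm (4 * (entropy_gap (f x) + exp (x\<^sup>2 / 4)))"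
      using pos[of x] entropy_gap_nonneg[OF pos, of x]
      by (simp add: abs_of_nonneg add_nonneg_nonneg less_imp_le)
  qed
qed simp

text \<open>Talagrand's inequality on the line with its remainder term. For finite entropy all terms are
  integrable, and the claim becomes the integral of a pointwise identity between \<open>(S y - y)\<^sup>2\<close>,
  \<open>log_gap (w y)\<close> and \<open>ln (f (S y))\<close>, in which the remaining terms cancel by integration by parts.\<close>

lemma talagrand_line:
  assumes u: "pos_density u"
  defines "S \<equiv> monotone_transport std_normal_density u"
    and "w \<equiv> transport_slope std_normal_density u"
  shows "(\<integral>\<^sup>+y. ennreal ((S y - y)\<^sup>2) \<partial>gauss_line) + (\<integral>\<^sup>+y. ennreal (2 * log_gap (w y)) \<partial>gauss_line)
     \<le> 2 * (\<integral>\<^sup>+x. ennreal (entropy_gap (u x / std_normal_density x)) \<partial>gauss_line)"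
proof (cases "(\<integral>\<^sup>+x. ennreal (entropy_gap (u x / std_normal_density x)) \<partial>gauss_line) = \<infinity>")
  case False
  note n = pos_density_std_normal
  interpret prob_space gauss_line by (rule prob_space_gauss_line)
  have prob_UNIV [simp]: "measure gauss_line UNIV = 1" using prob_space by simp
  define f where "f x = u x / std_normal_density x" for x
  note [measurable] = pos_density_measurable[OF u]
    measurable_transport_slope[OF n u, folded w_def] measurable_monotone_transport[OF n u, folded S_def]
  have [measurable]: "f \<in> borel_measurable borel" unfolding f_def by simp
  have fpos: "0 < f x" and npos: "0 < std_normal_density x" for x
    using pos_density_pos[OF u] by (simp_all add: f_def normal_density_pos)
  have wpos: "0 < w y" for y unfolding w_def by (rule transport_slope_pos[OF n u])
  have uf: "u x = std_normal_density x * f x" for x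
    using npos[of x] by (simp add: f_def)
  have push: "distr gauss_line borel S = density lborel u"
    unfolding S_def by (rule distr_monotone_transport[OF n u])
  \<comment> \<open>integrals along the transport are integrals against \<open>f\<close>\<close>
  have integrable_push: "integrable gauss_line (\<lambda>y. g (S y)) \<longleftrightarrow> integrable gauss_line (\<lambda>x. f x * g x)"
    and integral_push: "(\<integral>y. g (S y) \<partial>gauss_line) = (\<integral>x. f x * g x \<partial>gauss_line)"
    if [measurable]: "g \<in> borel_measurable borel" for g :: "real \<Rightarrow> real"
  proof -
    have "integrable gauss_line (\<lambda>y. g (S y)) \<longleftrightarrow> integrable (distr gauss_line borel S) g"
      by (subst integrable_distr_eq) auto
    also have "\<dots> \<longleftrightarrow> integrable lborel (\<lambda>x. u x * g x)"
      unfolding push using pos_density_pos[OF u] by (subst integrable_density) (auto simp: less_imp_le)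
    finally show "integrable gauss_line (\<lambda>y. g (S y)) \<longleftrightarrow> integrable gauss_line (\<lambda>x. f x * g x)"
      by (simp add: integrable_gauss_line_iff uf ac_simps)
    have "(\<integral>y. g (S y) \<partial>gauss_line) = integral\<^sup>L (distr gauss_line borel S) g"
      by (subst integral_distr) auto
    also have "\<dots> = (\<integral>x. u x * g x \<partial>lborel)"
      unfolding push using pos_density_pos[OF u] by (subst integral_density) (auto simp: less_imp_le)
    finally show "(\<integral>y. g (S y) \<partial>gauss_line) = (\<integral>x. f x * g x \<partial>gauss_line)"
      by (simp add: integral_gauss_line uf ac_simps)
  qed
  have int_gap: "integrable gauss_line (\<lambda>x. entropy_gap (f x))"
    using False entropy_gap_nonneg[OF fpos] 
    by (intro integrableI_nonneg) (auto simp: f_def[symmetric] less_top)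
  have int_f: "integrable gauss_line f" and f_1: "integral\<^sup>L gauss_line f = 1"
    using integrable_push[of "\<lambda>_. 1"] integral_push[of "\<lambda>_. 1"] prob_space by simp_all
  have "integrable gauss_line (\<lambda>x. entropy_gap (f x) + f x - 1)"
    using int_gap int_f by auto
  then have int_ent: "integrable gauss_line (\<lambda>x. f x * ln (f x))"
    by (simp add: entropy_gap_def)
  have "entropy_gap (f x) = f x * ln (f x) - f x + 1" for x by (simp add: entropy_gap_def)
  then have ent_eq: "(\<integral>x. entropy_gap (f x) \<partial>gauss_line) = (\<integral>x. f x * ln (f x) \<partial>gauss_line)"
    using int_ent int_f f_1 by (simp add: prob_space)
  have int_S2: "integrable gauss_line (\<lambda>y. (S y)\<^sup>2)"
    using integrable_push[of "\<lambda>x. x\<^sup>2"] entropy_finite_second_moment[OF _ fpos int_gap] by simp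
  have int_yS: "integrable gauss_line (\<lambda>y. y * S y)"
  proof (rule Bochner_Integration.integrable_bound)
    show "integrable gauss_line (\<lambda>y. y\<^sup>2 + (S y)\<^sup>2)" using int_S2 gauss_line_moments by auto
    show "AE y in gauss_line. norm (y * S y) \<le> norm (y\<^sup>2 + (S y)\<^sup>2)"
    proof (rule AE_I2)
      fix y
      have "2 * \<bar>y * S y\<bar> \<le> y\<^sup>2 + (S y)\<^sup>2"
        using sum_squares_bound[of "\<bar>y\<bar>" "\<bar>S y\<bar>"] by (simp add: abs_mult)
      then show "norm (y * S y) \<le> norm (y\<^sup>2 + (S y)\<^sup>2)" by simp
    qed
  qed simp
  have slope: "(\<integral>\<^sup>+y. ennreal (w y) \<partial>gauss_line) = (\<integral>\<^sup>+z. ennreal (z * (S z - S 0)) \<partial>gauss_line)"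
    unfolding w_def S_def by (rule nn_integral_slope_gauss_line[OF u])
  have prod_nonneg: "0 \<le> z * (S z - S 0)" for z
    using strict_mono_less_eq[OF strict_mono_monotone_transport[OF n u], folded S_def]
    by (cases "0 \<le> z") (auto intro: mult_nonpos_nonpos)
  have int_prod: "integrable gauss_line (\<lambda>z. z * (S z - S 0))"
    using int_yS gauss_line_moments by (simp add: right_diff_distrib)
  have "(\<integral>\<^sup>+y. ennreal (w y) \<partial>gauss_line) = ennreal (\<integral>z. z * (S z - S 0) \<partial>gauss_line)"
    unfolding slope by (rule nn_integral_eq_integral) (auto intro: int_prod prod_nonneg)
  then have int_w: "integrable gauss_line w"
    and w_eq: "integral\<^sup>L gauss_line w = (\<integral>z. z * (S z - S 0) \<partial>gauss_line)"
    using wpos prod_nonneg by (auto intro!: integrableI_nonneg integral_eq_nn_integral[THEN trans]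
      Bochner_Integration.integral_nonneg simp: less_imp_le)
  have w_eq': "integral\<^sup>L gauss_line w = (\<integral>y. y * S y \<partial>gauss_line)"
    using int_yS gauss_line_moments unfolding w_eq by (simp add: right_diff_distrib)
  \<comment> \<open>the Monge--Ampere equation \<open>u (S y) S' (y) = \<phi> y\<close> in logarithmic form\<close>
  have ln_f: "ln (f (S y)) = - ln (w y) + (S y)\<^sup>2 / 2 - y\<^sup>2 / 2" for y
  proof -
    have "f (S y) = std_normal_density y / (w y * std_normal_density (S y))"
      using npos[of "S y"] npos[of y] pos_density_pos[OF u, of "S y"]
      by (simp add: f_def w_def transport_slope_def S_def)
    also have "\<dots> = exp (- y\<^sup>2 / 2 + (S y)\<^sup>2 / 2) / w y"
      unfolding std_normal_density_def exp_add by (simp add: exp_minus field_simps)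
    finally show ?thesis using wpos[of y] by (simp add: ln_div)
  qed
  have int_lnf: "integrable gauss_line (\<lambda>y. ln (f (S y)))"
    using integrable_push[of "\<lambda>x. ln (f x)"] int_ent by simp
  have gap: "2 * log_gap (w y) = 2 * ln (f (S y)) + 2 * w y - 2 - (S y)\<^sup>2 + y\<^sup>2" for y
    by (simp add: log_gap_def ln_f)
  have int_log_gap: "integrable gauss_line (\<lambda>y. 2 * log_gap (w y))"
    unfolding gap using int_lnf int_w int_S2 gauss_line_moments by auto
  have sq: "(S y - y)\<^sup>2 = (S y)\<^sup>2 - 2 * (y * S y) + y\<^sup>2" for y
    by (simp add: power2_eq_square algebra_simps)
  have int_sq: "integrable gauss_line (\<lambda>y. (S y - y)\<^sup>2)"
    unfolding sq using int_yS int_S2 gauss_line_moments by auto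
  have "(\<integral>y. (S y - y)\<^sup>2 \<partial>gauss_line) + (\<integral>y. 2 * log_gap (w y) \<partial>gauss_line)
      = (\<integral>y. (S y - y)\<^sup>2 + 2 * log_gap (w y) \<partial>gauss_line)"
    using int_sq int_log_gap by simp
  also have "\<dots> = (\<integral>y. 2 * ln (f (S y)) + 2 * w y - 2 - 2 * (y * S y) + 2 * y\<^sup>2 \<partial>gauss_line)"
    unfolding gap sq by (intro Bochner_Integration.integral_cong) auto
  \<comment> \<open>\<open>w\<close> cancels against \<open>y * S y\<close> by integration by parts, and \<open>- 2\<close> against \<open>2 * y\<^sup>2\<close>
     because the Gaussian has variance 1\<close>
  also have "\<dots> = 2 * (\<integral>y. ln (f (S y)) \<partial>gauss_line)"
    using int_lnf int_w int_yS gauss_line_moments w_eq' by (simp add: prob_space)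
  also have "\<dots> = 2 * (\<integral>x. entropy_gap (f x) \<partial>gauss_line)"
    using integral_push[of "\<lambda>x. ln (f x)"] ent_eq by simp
  finally have *: "(\<integral>y. (S y - y)\<^sup>2 \<partial>gauss_line) + (\<integral>y. 2 * log_gap (w y) \<partial>gauss_line)
     = 2 * (\<integral>x. entropy_gap (f x) \<partial>gauss_line)" .
  have nn: "(\<integral>\<^sup>+y. ennreal ((S y - y)\<^sup>2) \<partial>gauss_line) = ennreal (\<integral>y. (S y - y)\<^sup>2 \<partial>gauss_line)"
    "(\<integral>\<^sup>+y. ennreal (2 * log_gap (w y)) \<partial>gauss_line) = ennreal (\<integral>y. 2 * log_gap (w y) \<partial>gauss_line)"
    "(\<integral>\<^sup>+x. ennreal (entropy_gap (f x)) \<partial>gauss_line) = ennreal (\<integral>x. entropy_gap (f x) \<partial>gauss_line)"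
    using nn_integral_eq_integral[OF int_sq] nn_integral_eq_integral[OF int_log_gap]
      nn_integral_eq_integral[OF int_gap] log_gap_nonneg[OF wpos] entropy_gap_nonneg[OF fpos]
    by simp_all
  have "ennreal (\<integral>y. (S y - y)\<^sup>2 \<partial>gauss_line) + ennreal (\<integral>y. 2 * log_gap (w y) \<partial>gauss_line)
      = ennreal (2 * (\<integral>x. entropy_gap (f x) \<partial>gauss_line))"
    unfolding *[symmetric]
    using log_gap_nonneg[OF wpos] by (intro ennreal_plus[symmetric] Bochner_Integration.integral_nonneg) auto
  also have "\<dots> = 2 * ennreal (\<integral>x. entropy_gap (f x) \<partial>gauss_line)"
    by (subst ennreal_mult) (auto intro!: Bochner_Integration.integral_nonneg entropy_gap_nonneg fpos)
  finally show ?thesis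
    unfolding f_def[symmetric] nn by simp
qed (simp add: ennreal_mult_top)

section \<open>The one-dimensional distance is controlled by the logarithmic gap\<close>

text \<open>At \<open>w = 1\<close> both sides vanish, and their difference is monotone on either side of this point. The
  maximum makes the left side \<open>(1 - 1 / w)\<^sup>2\<close> for \<open>w \<ge> 1\<close> and \<open>(1 - w)\<^sup>2\<close> for \<open>w \<le> 1\<close>.\<close>

lemma dist_integrand_le_log_gap:
  fixes w :: real assumes "0 < w"
  shows "(\<bar>1 - 1 / w\<bar> / max 1 (1 / w))\<^sup>2 \<le> 2 * log_gap w"
proof (cases "1 \<le> w")
  case True
  have "2 * log_gap 1 - (1 - 1 / 1)\<^sup>2 \<le> 2 * log_gap w - (1 - 1 / w)\<^sup>2"
  proof (rule DERIV_nonneg_imp_nondecreasing[OF True, where f = "\<lambda>x. 2 * log_gap x - (1 - 1 / x)\<^sup>2"])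
    fix x :: real assume x: "1 \<le> x"
    have "((\<lambda>x. 2 * log_gap x - (1 - 1 / x)\<^sup>2) has_real_derivative 2 * (1 - 1 / x) * (1 - 1 / x\<^sup>2)) (at x)"
      unfolding log_gap_def using x
      by (auto intro!: derivative_eq_intros simp: field_simps power2_eq_square)
    moreover have "0 \<le> 2 * (1 - 1 / x) * (1 - 1 / x\<^sup>2)"
      using x one_le_power[OF x, of 2] by (intro mult_nonneg_nonneg) (auto simp: divide_le_eq_1)
    ultimately show "\<exists>y. ((\<lambda>x. 2 * log_gap x - (1 - 1 / x)\<^sup>2) has_real_derivative y) (at x) \<and> 0 \<le> y"
      by blast
  qed
  with True show ?thesis by (simp add: log_gap_def max_def)
next
  case False
  have "2 * log_gap 1 - (1 - 1)\<^sup>2 \<le> 2 * log_gap w - (1 - w)\<^sup>2"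
  proof (rule DERIV_nonpos_imp_nonincreasing[where f = "\<lambda>x. 2 * log_gap x - (1 - x)\<^sup>2"])
    show "w \<le> 1" using False by simp
    fix x assume x: "w \<le> x" "x \<le> 1"
    have "((\<lambda>x. 2 * log_gap x - (1 - x)\<^sup>2) has_real_derivative 2 * (1 - x) * (1 - 1 / x)) (at x)"
      unfolding log_gap_def using x assms
      by (auto intro!: derivative_eq_intros simp: field_simps power2_eq_square)
    moreover have "2 * (1 - x) * (1 - 1 / x) \<le> 0"
      using x assms by (intro mult_nonneg_nonpos) auto
    ultimately show "\<exists>y. ((\<lambda>x. 2 * log_gap x - (1 - x)\<^sup>2) has_real_derivative y) (at x) \<and> y \<le> 0"
      by blast
  qed
  moreover have "\<bar>1 - 1 / w\<bar> / max 1 (1 / w) = 1 - w"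
    using False assms by (simp add: max_def abs_if field_simps)
  ultimately show ?thesis by (simp add: log_gap_def)
qed

lemma class_B_cdf_of_derivative:
  assumes "u \<in> class_B" shows "(cdf_of u has_real_derivative u x) (at x)"
proof -
  have u: "pos_density u" by (rule class_B_pos_density[OF assms])
  have c: "continuous_on A u" and i: "integrable lborel u" for A
    using assms by (auto simp: class_B_def has_bochner_integral_iff intro: continuous_on_subset)
  have si: "set_integrable lborel A u" if "A \<in> sets borel" for A
    using i that integrable_mult_indicator[of A lborel u] by (auto simp: set_integrable_def)
  have eq: "cdf_of u y = cdf_of u (x - 1) + integral {x - 1..y} u" if "x - 1 \<le> y" for y
  proof -
    have "{..y} = {..x - 1} \<union> {x - 1<..y}" using that by auto
    then have "cdf_of u y = cdf_of u (x - 1) + (LINT z:{x - 1<..y}|lborel. u z)"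
      unfolding cdf_of_def by (simp only:) (rule set_integral_Un, auto intro!: si)
    also have "(LINT z:{x - 1<..y}|lborel. u z) = (LINT z:{x - 1..y}|lborel. u z)"
    proof (rule set_integral_null_delta[OF i])
      have "({x - 1<..y} - {x - 1..y}) \<union> ({x - 1..y} - {x - 1<..y}) = {x - 1}"
        using that by auto
      then show "({x - 1<..y} - {x - 1..y}) \<union> ({x - 1..y} - {x - 1<..y}) \<in> null_sets lborel"
        by (simp add: null_sets_def)
    qed auto
    also have "\<dots> = integral {x - 1..y} u"
      by (rule set_borel_integral_eq_integral) (rule si, simp)
    finally show ?thesis .
  qed
  have "((\<lambda>y. cdf_of u (x - 1) + integral {x - 1..y} u) has_real_derivative u x) (at x within {x - 1..x + 1})"
    by (auto intro!: derivative_eq_intros integral_has_real_derivative c)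
  then have "((\<lambda>y. cdf_of u (x - 1) + integral {x - 1..y} u) has_real_derivative u x) (at x)"
    by (simp add: at_within_Icc_at)
  then show ?thesis
  proof (rule DERIV_cong_ev[THEN iffD1, rotated -1, OF _ refl _ refl])
    have "\<forall>\<^sub>F y in nhds x. y \<in> {x - 1<..}"
      by (rule eventually_nhds_in_open) auto
    then show "\<forall>\<^sub>F y in nhds x. cdf_of u (x - 1) + integral {x - 1..y} u = cdf_of u y"
    proof eventually_elim
      case (elim y)
      then show ?case using eq[of y] by simp
    qed
  qed
qed

lemma class_B_deriv_monotone_transport:
  assumes u: "u \<in> class_B" and v: "v \<in> class_B"
  shows "deriv (monotone_transport u v) x = u x / v (monotone_transport u v x)"
proof -
  note pu = class_B_pos_density[OF u] and pv = class_B_pos_density[OF v]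
  let ?T = "monotone_transport u v" and ?g = "inv (cdf_of v)"
  have inv: "cdf_of v (?g p) = p" if "0 < p" "p < 1" for p
    using that by (intro f_inv_into_f) (simp add: range_cdf_of[OF pv])
  have inj: "?g (cdf_of v y) = y" for y
    by (intro inv_f_f strict_mono_imp_inj_on cdf_of_strict_mono pv)
  have p: "0 < cdf_of u x" "cdf_of u x < 1" 
    using rangeI[of "cdf_of u" x] by (auto simp: range_cdf_of[OF pu])
  have T: "?T x = ?g (cdf_of u x)" by (simp add: monotone_transport_def)
  have "isCont ?g (cdf_of v (?T x))"
    by (rule isCont_inverse_function[where d = 1]) (auto intro: inj isCont_cdf_of pv)
  then have "isCont ?g (cdf_of u x)"
    by (simp add: cdf_of_monotone_transport[OF pu pv])
  then have "(?g has_real_derivative inverse (v (?T x))) (at (cdf_of u x))"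
    unfolding T using p class_B_cdf_of_derivative[OF v] pos_density_pos[OF pv, THEN less_imp_neq]
    by (intro DERIV_inverse_function[where f = "cdf_of v" and a = 0 and b = 1]) (auto intro: inv)
  then have "((\<lambda>x. ?g (cdf_of u x)) has_real_derivative inverse (v (?T x)) * u x) (at x)"
    by (rule DERIV_chain2) (rule class_B_cdf_of_derivative[OF u])
  then show ?thesis
    by (intro DERIV_imp_deriv) (simp add: monotone_transport_def comp_def divide_inverse mult.commute)
qed

lemma std_normal_class_B: "std_normal_density \<in> class_B"
proof -
  have "continuous_on UNIV std_normal_density"
    unfolding std_normal_density_def by (intro continuous_intros) auto
  then show ?thesis
    by (simp add: class_B_def has_bochner_integral_iff normal_density_pos)
qed

text \<open>The distance is defined through the map from \<open>u\<close> to the Gaussian. Its derivative at \<open>S y\<close> is the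
  reciprocal of the slope of the inverse map \<open>S\<close> at \<open>y\<close>.\<close>

lemma dist1_std_normal:
  assumes u: "u \<in> class_B"
  defines "w \<equiv> transport_slope std_normal_density u"
  shows "dist1 u std_normal_density = (\<integral>y. \<bar>1 - 1 / w y\<bar> / max 1 (1 / w y) \<partial>gauss_line)"
proof -
  note n = std_normal_class_B
  note pu = class_B_pos_density[OF u] and pn = class_B_pos_density[OF n]
  let ?S = "monotone_transport std_normal_density u" and ?T = "monotone_transport u std_normal_density"
  note [measurable] = pos_density_measurable[OF pu] measurable_monotone_transport[OF pn pu]
    measurable_monotone_transport[OF pu pn]
  let ?q = "\<lambda>x. u x / std_normal_density (?T x)"
  have "dist1 u std_normal_density = (\<integral>x. \<bar>1 - ?q x\<bar> / max 1 (?q x) \<partial>density lborel u)"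
    unfolding dist1_def class_B_deriv_monotone_transport[OF u n] by simp
  also have "\<dots> = (\<integral>y. \<bar>1 - ?q (?S y)\<bar> / max 1 (?q (?S y)) \<partial>gauss_line)"
    unfolding distr_monotone_transport[OF pn pu, symmetric] by (subst integral_distr) auto
  finally show ?thesis
    by (simp add: monotone_transport_inverse[OF pn pu] w_def transport_slope_def)
qed

lemma dist1_std_normal_le:
  assumes u: "u \<in> class_B"
  shows "ennreal ((dist1 u std_normal_density)\<^sup>2)
     \<le> (\<integral>\<^sup>+y. ennreal (2 * log_gap (transport_slope std_normal_density u y)) \<partial>gauss_line)"
    and "0 \<le> dist1 u std_normal_density"
proof -
  interpret prob_space gauss_line by (rule prob_space_gauss_line)
  note pu = class_B_pos_density[OF u]
  let ?w = "transport_slope std_normal_density u"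
  define t where "t y = \<bar>1 - 1 / ?w y\<bar> / max 1 (1 / ?w y)" for y
  note [measurable] = measurable_transport_slope[OF pos_density_std_normal pu]
  have [measurable]: "t \<in> borel_measurable borel" unfolding t_def by simp
  have wpos: "0 < ?w y" for y by (rule transport_slope_pos[OF pos_density_std_normal pu])
  have t0: "0 \<le> t y" for y unfolding t_def by simp
  have t1: "t y \<le> 1" for y using wpos[of y] unfolding t_def by (auto simp: divide_le_eq_1 max_def)
  have int: "integrable gauss_line t" "integrable gauss_line (\<lambda>y. (t y)\<^sup>2)"
    by (auto intro!: integrable_const_bound[where B = 1] simp: t0 t1 power_le_one)
  have d: "dist1 u std_normal_density = expectation t"
    unfolding dist1_std_normal[OF u] t_def ..
  then show "0 \<le> dist1 u std_normal_density"
    using t0 by simp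
  \<comment> \<open>Cauchy--Schwarz, as nonnegativity of the variance\<close>
  have "(expectation t)\<^sup>2 \<le> expectation (\<lambda>y. (t y)\<^sup>2)"
    using variance_eq[OF int] variance_positive[of t] by simp
  then have "ennreal ((dist1 u std_normal_density)\<^sup>2) \<le> (\<integral>\<^sup>+y. ennreal ((t y)\<^sup>2) \<partial>gauss_line)"
    using int by (simp add: d nn_integral_eq_integral ennreal_leI)
  also have "\<dots> \<le> (\<integral>\<^sup>+y. ennreal (2 * log_gap (?w y)) \<partial>gauss_line)"
    unfolding t_def by (intro nn_integral_mono ennreal_leI dist_integrand_le_log_gap wpos)
  finally show "ennreal ((dist1 u std_normal_density)\<^sup>2)
     \<le> (\<integral>\<^sup>+y. ennreal (2 * log_gap (?w y)) \<partial>gauss_line)" .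
qed

section \<open>Splitting off one coordinate\<close>

text \<open>The chain rule for relative entropy on one fibre, where \<open>a\<close> is the marginal density at the base
  point and \<open>c\<close> the conditional density along the fibre. The cross term \<open>(c t - 1) * (a * ln a)\<close>
  integrates to zero.\<close>

lemma (in prob_space) entropy_gap_scale:
  assumes [measurable]: "c \<in> borel_measurable M" and pos: "\<And>t. 0 < c t" and a: "0 < a"
    and total: "(\<integral>\<^sup>+t. ennreal (c t) \<partial>M) = 1"
  shows "ennreal (entropy_gap a) + ennreal a * (\<integral>\<^sup>+t. ennreal (entropy_gap (c t)) \<partial>M)
    \<le> (\<integral>\<^sup>+t. ennreal (entropy_gap (a * c t)) \<partial>M)"
proof (cases "(\<integral>\<^sup>+t. ennreal (entropy_gap (a * c t)) \<partial>M) = \<infinity>")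
  case False
  have split: "entropy_gap (a * c t) = a * entropy_gap (c t) + entropy_gap a + (c t - 1) * (a * ln a)" for t
    using a pos[of t] by (simp add: entropy_gap_def ln_mult algebra_simps)
  have int_c: "integrable M c" and c1: "expectation c = 1"
    using total pos by (auto intro!: integrableI_nonneg simp: integral_eq_nn_integral less_imp_le)
  have int_ac: "integrable M (\<lambda>t. entropy_gap (a * c t))"
    using False a pos by (intro integrableI_nonneg) (auto simp: less_top intro!: entropy_gap_nonneg)
  have "integrable M (\<lambda>t. (entropy_gap (a * c t) - entropy_gap a - (c t - 1) * (a * ln a)) / a)"
    using int_ac int_c by auto
  also have "(\<lambda>t. (entropy_gap (a * c t) - entropy_gap a - (c t - 1) * (a * ln a)) / a) = (\<lambda>t. entropy_gap (c t))"
    using a by (simp add: split)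
  finally have int_gap: "integrable M (\<lambda>t. entropy_gap (c t))" .
  have "expectation (\<lambda>t. entropy_gap (a * c t)) = a * expectation (\<lambda>t. entropy_gap (c t)) + entropy_gap a"
    unfolding split using int_gap int_c c1 prob_space by simp
  moreover have "(\<integral>\<^sup>+t. ennreal (entropy_gap (a * c t)) \<partial>M) = ennreal (expectation (\<lambda>t. entropy_gap (a * c t)))"
    "(\<integral>\<^sup>+t. ennreal (entropy_gap (c t)) \<partial>M) = ennreal (expectation (\<lambda>t. entropy_gap (c t)))"
    using nn_integral_eq_integral[OF int_ac] nn_integral_eq_integral[OF int_gap] a pos entropy_gap_nonneg
    by simp_all
  moreover have "0 \<le> expectation (\<lambda>t. entropy_gap (c t))"
    using pos by (intro Bochner_Integration.integral_nonneg entropy_gap_nonneg)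
  ultimately show ?thesis
    using a entropy_gap_nonneg[OF a] by (simp add: ennreal_mult[symmetric] add.commute flip: ennreal_plus)
qed simp

text \<open>Disintegration of a positive density on a product into marginal and conditional densities.
  On the null set where the fibre integral diverges both factors are set to 1, so that the conditional
  density is a probability density on every fibre and has a transport map there.\<close>

lemma disintegrate_density:
  fixes f :: "'a \<Rightarrow> real \<Rightarrow> real"
  assumes M: "prob_space M"
    and f: "case_prod f \<in> borel_measurable (M \<Otimes>\<^sub>M borel)" and pos: "\<And>x t. 0 < f x t"
    and total: "(\<integral>\<^sup>+x. \<integral>\<^sup>+t. ennreal (f x t) \<partial>gauss_line \<partial>M) = 1"
  obtains F c where "F \<in> borel_measurable M" "case_prod c \<in> borel_measurable (M \<Otimes>\<^sub>M borel)"
    "\<And>x. 0 < F x" "\<And>x t. 0 < c x t" "\<And>x. x \<in> space M \<Longrightarrow> (\<integral>\<^sup>+t. ennreal (c x t) \<partial>gauss_line) = 1"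
    "AE x in M. \<forall>t. f x t = F x * c x t"
proof -
  interpret M: prob_space M by fact
  interpret G: prob_space gauss_line by (rule prob_space_gauss_line)
  note [measurable] = f
  define J where "J x = (\<integral>\<^sup>+t. ennreal (f x t) \<partial>gauss_line)" for x
  have J: "J \<in> borel_measurable M"
    unfolding J_def by (rule G.borel_measurable_nn_integral) (use f in \<open>simp add: case_prod_beta'\<close>)
  note [measurable] = J
  have fx: "f x \<in> borel_measurable borel" if "x \<in> space M" for x
    using measurable_compose[OF measurable_Pair1'[OF that] f] by simp
  define ok where "ok x \<longleftrightarrow> 0 < J x \<and> J x < \<infinity>" for x
  define F where "F x = (if ok x then enn2real (J x) else 1)" for x
  define c where "c x t = (if ok x then f x t / enn2real (J x) else 1)" for x t
  have ok_meas [measurable]: "Measurable.pred M ok" unfolding ok_def by measurable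
  have Jpos: "0 < enn2real (J x)" if "ok x" for x
    using that by (simp add: ok_def enn2real_positive_iff)
  show ?thesis
  proof
    show "F \<in> borel_measurable M" unfolding F_def by measurable
    show "case_prod c \<in> borel_measurable (M \<Otimes>\<^sub>M borel)" unfolding c_def by measurable
    show "0 < F x" for x unfolding F_def using Jpos by simp
    show "0 < c x t" for x t unfolding c_def using Jpos pos by simp
    show "(\<integral>\<^sup>+t. ennreal (c x t) \<partial>gauss_line) = 1" if x: "x \<in> space M" for x
    proof (cases "ok x")
      case True
      have "(\<integral>\<^sup>+t. ennreal (c x t) \<partial>gauss_line) = (\<integral>\<^sup>+t. ennreal (f x t) / ennreal (enn2real (J x)) \<partial>gauss_line)"
        using True pos Jpos by (intro nn_integral_cong) (simp add: c_def divide_ennreal less_imp_le)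
      also have "\<dots> = J x / ennreal (enn2real (J x))"
        unfolding J_def using fx[OF x] by (intro nn_integral_divide) simp
      also have "\<dots> = 1"
        using True by (auto simp: ok_def intro!: ennreal_divide_self)
      finally show ?thesis .
    next
      case False
      then show ?thesis using G.emeasure_space_1 by (simp add: c_def)
    qed
    have "0 < J x" if x: "x \<in> space M" for x
    proof (rule ccontr)
      assume "\<not> 0 < J x"
      then have "AE t in gauss_line. ennreal (f x t) = 0"
        unfolding J_def using fx[OF x] by (subst nn_integral_0_iff_AE[symmetric]) auto
      then have "AE t in gauss_line. False"
        by (rule AE_mp) (use pos in \<open>auto simp: ennreal_eq_0_iff simp flip: not_less\<close>)
      then show False by simp
    qed
    moreover have "AE x in M. J x \<noteq> \<infinity>"
      using total by (intro nn_integral_PInf_AE) (auto simp: J_def)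
    ultimately have "AE x in M. ok x"
      by (auto simp: ok_def less_top elim!: AE_mp)
    then show "AE x in M. \<forall>t. f x t = F x * c x t"
      by (rule AE_mp) (use Jpos in \<open>auto simp: F_def c_def intro!: AE_I2\<close>, fastforce dest: Jpos)
  qed
qed

text \<open>The sublevel sets of the fibrewise transport compare the distribution functions of the two
  densities, and these depend measurably on the base point.\<close>

lemma measurable_fibre_transport:
  fixes u :: "'a \<Rightarrow> real \<Rightarrow> real"
  assumes u: "case_prod u \<in> borel_measurable (M \<Otimes>\<^sub>M borel)"
    and dens: "\<And>x. x \<in> space M \<Longrightarrow> pos_density (u x)" and v: "pos_density v"
  shows "(\<lambda>(x, t). monotone_transport v (u x) t) \<in> borel_measurable (M \<Otimes>\<^sub>M borel)"
proof (rule borel_measurableI_le)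
  fix s
  note [measurable] = u
  have [measurable]: "cdf_of v \<in> borel_measurable borel"
    by (intro borel_measurable_mono strict_mono_mono cdf_of_strict_mono v)
  have "(\<lambda>x. cdf_of (u x) s) = (\<lambda>x. \<integral>t. indicator {..s} t * u x t \<partial>lborel)"
    by (simp add: cdf_of_def set_lebesgue_integral_def)
  also have "\<dots> \<in> borel_measurable M"
    by (rule sigma_finite_measure.borel_measurable_lebesgue_integral[OF sigma_finite_lborel])
      (simp add: case_prod_beta')
  finally have [measurable]: "(\<lambda>x. cdf_of (u x) s) \<in> borel_measurable M" .
  have "{p \<in> space (M \<Otimes>\<^sub>M borel). (case p of (x, t) \<Rightarrow> monotone_transport v (u x) t) \<le> s}
      = {p \<in> space (M \<Otimes>\<^sub>M borel). cdf_of v (snd p) \<le> cdf_of (u (fst p)) s}"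
    using dens by (auto simp: space_pair_measure monotone_transport_le_iff[OF v])
  also have "\<dots> \<in> sets (M \<Otimes>\<^sub>M borel)" by measurable
  finally show "{p \<in> space (M \<Otimes>\<^sub>M borel). (case p of (x, t) \<Rightarrow> monotone_transport v (u x) t) \<le> s}
     \<in> sets (M \<Otimes>\<^sub>M borel)" .
qed

text \<open>\<open>D\<close> is a surplus by which the cost of a transport map stays below twice the entropy. It is
  added to the cost, so that the inequality keeps its meaning when the entropy is infinite.\<close>

definition transport_bound :: "'a measure \<Rightarrow> ('a \<Rightarrow> 'a \<Rightarrow> real) \<Rightarrow> ennreal \<Rightarrow> ('a \<Rightarrow> real) \<Rightarrow> bool" where
  "transport_bound M cost D f \<longleftrightarrow>
    (\<exists>S\<in>measurable M M. distr M M S = density M (\<lambda>x. ennreal (f x)) \<and>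
      (\<integral>\<^sup>+x. ennreal (cost x (S x)) \<partial>M) + D \<le> 2 * (\<integral>\<^sup>+x. ennreal (entropy_gap (f x)) \<partial>M))"

lemma pos_density_gauss_times:
  assumes "c \<in> borel_measurable borel" "\<And>t. 0 < c t" "(\<integral>\<^sup>+t. ennreal (c t) \<partial>gauss_line) = 1"
  shows "pos_density (\<lambda>t. std_normal_density t * c t)"
  using assms by (simp add: pos_density_def normal_density_pos nn_integral_density ennreal_mult less_imp_le)


lemma nn_integral_density_Times_gauss:
  assumes "prob_space M" and F: "F \<in> borel_measurable M" and F0: "\<And>x. 0 < F x"
    and f: "f \<in> borel_measurable (M \<Otimes>\<^sub>M gauss_line)"
    and c: "case_prod c \<in> borel_measurable (M \<Otimes>\<^sub>M borel)"
    and eq: "AE x in M. \<forall>t. f (x, t) = F x * c x t"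
    and g: "g \<in> borel_measurable (M \<Otimes>\<^sub>M gauss_line)"
  shows "(\<integral>\<^sup>+p. ennreal (f p) * g p \<partial>(M \<Otimes>\<^sub>M gauss_line))
       = (\<integral>\<^sup>+x. ennreal (F x) * (\<integral>\<^sup>+t. ennreal (c x t) * g (x, t) \<partial>gauss_line) \<partial>M)"
proof -
  interpret G: prob_space gauss_line by (rule prob_space_gauss_line)
  note [measurable] = F f c g
  have "(\<integral>\<^sup>+p. ennreal (f p) * g p \<partial>(M \<Otimes>\<^sub>M gauss_line))
      = (\<integral>\<^sup>+x. \<integral>\<^sup>+t. ennreal (f (x, t)) * g (x, t) \<partial>gauss_line \<partial>M)"
    by (rule G.nn_integral_fst[symmetric]) measurable
  also have "\<dots> = (\<integral>\<^sup>+x. ennreal (F x) * (\<integral>\<^sup>+t. ennreal (c x t) * g (x, t) \<partial>gauss_line) \<partial>M)"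
  proof (rule nn_integral_cong_AE)
    have "AE x in M. x \<in> space M" by (rule AE_space)
    with eq show "AE x in M. (\<integral>\<^sup>+t. ennreal (f (x, t)) * g (x, t) \<partial>gauss_line)
      = ennreal (F x) * (\<integral>\<^sup>+t. ennreal (c x t) * g (x, t) \<partial>gauss_line)"
    proof eventually_elim
      case (elim x)
      have [measurable]: "c x \<in> borel_measurable borel" "(\<lambda>t. g (x, t)) \<in> borel_measurable gauss_line"
        using measurable_compose[OF measurable_Pair1'[OF elim(2)] c]
          measurable_compose[OF measurable_Pair1'[OF elim(2)] g] by simp_all
      have "(\<integral>\<^sup>+t. ennreal (f (x, t)) * g (x, t) \<partial>gauss_line)
          = (\<integral>\<^sup>+t. ennreal (F x) * (ennreal (c x t) * g (x, t)) \<partial>gauss_line)"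
        using elim F0[of x] by (intro nn_integral_cong) (simp add: ennreal_mult' less_imp_le mult.assoc)
      then show ?case by (simp add: nn_integral_cmult)
    qed
  qed
  finally show ?thesis .
qed

text \<open>Knothe's construction. The base moves by a map for the marginal density, and then each fibre
  is rearranged monotonically towards the conditional density over the \<^emph>\<open>image\<close> of the base point.
  Costs and entropies add up, while the surplus \<open>D\<close> of the base is kept.\<close>

lemma transport_bound_Times_gauss:
  fixes f :: "'a \<times> real \<Rightarrow> real"
  assumes M: "prob_space M"
    and cost: "case_prod cost \<in> borel_measurable (M \<Otimes>\<^sub>M M)" and cost_nonneg: "\<And>x y. 0 \<le> cost x y"
    and f: "f \<in> borel_measurable (M \<Otimes>\<^sub>M gauss_line)" and pos: "\<And>p. 0 < f p"
    and total: "(\<integral>\<^sup>+p. ennreal (f p) \<partial>(M \<Otimes>\<^sub>M gauss_line)) = 1"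
    and base: "\<And>F. F \<in> borel_measurable M \<Longrightarrow> (\<And>x. 0 < F x) \<Longrightarrow>
      density M (\<lambda>x. ennreal (F x)) = distr (density (M \<Otimes>\<^sub>M gauss_line) (\<lambda>p. ennreal (f p))) M fst \<Longrightarrow>
      transport_bound M cost D F"
  shows "transport_bound (M \<Otimes>\<^sub>M gauss_line) (\<lambda>p q. cost (fst p) (fst q) + (snd q - snd p)\<^sup>2) D f"
proof -
  interpret M: prob_space M by fact
  interpret G: prob_space gauss_line by (rule prob_space_gauss_line)
  let ?N = "M \<Otimes>\<^sub>M gauss_line"
  have sets_N: "sets ?N = sets (M \<Otimes>\<^sub>M borel)"
    by (intro sets_pair_measure_cong) auto
  have bm_N: "borel_measurable (M \<Otimes>\<^sub>M borel) = borel_measurable ?N"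
    by (intro measurable_cong_sets) (auto simp: sets_N)
  have "case_prod (\<lambda>x t. f (x, t)) \<in> borel_measurable (M \<Otimes>\<^sub>M borel)" using f by (simp add: bm_N)
  moreover have "(\<integral>\<^sup>+x. \<integral>\<^sup>+t. ennreal (f (x, t)) \<partial>gauss_line \<partial>M) = 1"
    using f total by (subst G.nn_integral_fst) auto
  ultimately obtain F c where F: "F \<in> borel_measurable M"
    and c: "case_prod c \<in> borel_measurable (M \<Otimes>\<^sub>M borel)"
    and F0: "\<And>x. 0 < F x" and c0: "\<And>x t. 0 < c x t"
    and c1: "\<And>x. x \<in> space M \<Longrightarrow> (\<integral>\<^sup>+t. ennreal (c x t) \<partial>gauss_line) = 1"
    and eq: "AE x in M. \<forall>t. f (x, t) = F x * c x t"
    using M pos by (elim disintegrate_density[rotated -1]) auto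
  note [measurable] = F f c cost
  note c_N [measurable] = c[unfolded bm_N]
  note split = nn_integral_density_Times_gauss[OF M F F0 f c eq]
  have cx [measurable]: "c x \<in> borel_measurable borel" if "x \<in> space M" for x
    using measurable_compose[OF measurable_Pair1'[OF that] c] by simp
  have "density M (\<lambda>x. ennreal (F x)) = distr (density ?N (\<lambda>p. ennreal (f p))) M fst"
  proof (rule measure_eqI)
    fix A assume "A \<in> sets (density M (\<lambda>x. ennreal (F x)))"
    then have A [measurable]: "A \<in> sets M" by simp
    have "emeasure (distr (density ?N (\<lambda>p. ennreal (f p))) M fst) A
        = (\<integral>\<^sup>+p. indicator A (fst p) \<partial>density ?N (\<lambda>p. ennreal (f p)))"
      by (subst nn_integral_distr[symmetric, of fst _ M]) auto
    also have "\<dots> = (\<integral>\<^sup>+p. ennreal (f p) * indicator A (fst p) \<partial>?N)"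
      by (subst nn_integral_density) auto
    also have "\<dots> = (\<integral>\<^sup>+x. ennreal (F x) * (\<integral>\<^sup>+t. ennreal (c x t) * indicator A (fst (x, t)) \<partial>gauss_line) \<partial>M)"
      by (rule split) measurable
    also have "\<dots> = (\<integral>\<^sup>+x. ennreal (F x) * indicator A x \<partial>M)"
      by (intro nn_integral_cong) (simp add: nn_integral_multc c1)
    also have "\<dots> = emeasure (density M (\<lambda>x. ennreal (F x))) A"
      by (simp add: emeasure_density)
    finally show "emeasure (density M (\<lambda>x. ennreal (F x))) A
        = emeasure (distr (density ?N (\<lambda>p. ennreal (f p))) M fst) A" ..
  qed simp
  then have "transport_bound M cost D F" using F F0 by (intro base)
  then obtain S1 where S1 [measurable]: "S1 \<in> measurable M M"
    and push1: "distr M M S1 = density M (\<lambda>x. ennreal (F x))"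
    and bound1: "(\<integral>\<^sup>+x. ennreal (cost x (S1 x)) \<partial>M) + D \<le> 2 * (\<integral>\<^sup>+x. ennreal (entropy_gap (F x)) \<partial>M)"
    by (auto simp: transport_bound_def)
  \<comment> \<open>Lebesgue density of the conditional law on the fibre over \<open>x\<close>\<close>
  define u where "u x t = std_normal_density t * c x t" for x t
  have u_dens: "pos_density (u x)" if "x \<in> space M" for x
    unfolding u_def using that c0 c1 by (intro pos_density_gauss_times) auto
  have [measurable]: "case_prod u \<in> borel_measurable (M \<Otimes>\<^sub>M borel)"
    unfolding u_def case_prod_beta' by measurable
  define S2 where "S2 x t = monotone_transport std_normal_density (u x) t" for x t
  have S2_borel: "(\<lambda>(x, t). S2 x t) \<in> borel_measurable (M \<Otimes>\<^sub>M borel)"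
    unfolding S2_def by (rule measurable_fibre_transport) (auto intro: u_dens pos_density_std_normal)
  then have S2_meas [measurable]: "(\<lambda>p. S2 (fst p) (snd p)) \<in> borel_measurable ?N"
    by (simp add: bm_N case_prod_beta')
  have S2x [measurable]: "S2 x \<in> borel_measurable borel" if "x \<in> space M" for x
    using measurable_compose[OF measurable_Pair1'[OF that] S2_borel] by simp
  have push2: "(\<integral>\<^sup>+t. g (S2 x t) \<partial>gauss_line) = (\<integral>\<^sup>+t. ennreal (c x t) * g t \<partial>gauss_line)"
    if x: "x \<in> space M" and [measurable]: "g \<in> borel_measurable borel" for g :: "real \<Rightarrow> ennreal" and x
  proof -
    have "(\<integral>\<^sup>+t. g (S2 x t) \<partial>gauss_line) = (\<integral>\<^sup>+t. g t \<partial>density lborel (u x))"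
      unfolding S2_def by (rule nn_integral_monotone_transport[OF pos_density_std_normal u_dens[OF x]]) simp
    also have "\<dots> = (\<integral>\<^sup>+t. ennreal (c x t) * g t \<partial>gauss_line)"
      using cx[OF x] c0 by (simp add: u_def nn_integral_density ennreal_mult less_imp_le mult.assoc)
    finally show ?thesis .
  qed
  have push1': "(\<integral>\<^sup>+x. g (S1 x) \<partial>M) = (\<integral>\<^sup>+x. ennreal (F x) * g x \<partial>M)"
    if [measurable]: "g \<in> borel_measurable M" for g :: "'a \<Rightarrow> ennreal"
  proof -
    have "(\<integral>\<^sup>+x. g (S1 x) \<partial>M) = (\<integral>\<^sup>+x. g x \<partial>distr M M S1)" by (simp add: nn_integral_distr)
    then show ?thesis by (simp add: push1 nn_integral_density)
  qed
  define S where "S p = (S1 (fst p), S2 (S1 (fst p)) (snd p))" for p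
  have "(\<lambda>p. (S1 (fst p), snd p)) \<in> measurable ?N ?N" by measurable
  from measurable_compose[OF this S2_meas]
  have S2S1 [measurable]: "(\<lambda>p. S2 (S1 (fst p)) (snd p)) \<in> borel_measurable ?N" by simp
  have S [measurable]: "S \<in> measurable ?N ?N"
    unfolding S_def by measurable
  show ?thesis
    unfolding transport_bound_def
  proof (intro bexI conjI)
    show "S \<in> measurable ?N ?N" by fact
    show "distr ?N ?N S = density ?N (\<lambda>p. ennreal (f p))"
    proof (rule measure_eqI)
      fix A assume "A \<in> sets (distr ?N ?N S)"
      then have A [measurable]: "A \<in> sets ?N" by simp
      have "(\<lambda>p. (fst p, S2 (fst p) (snd p))) \<in> measurable ?N ?N" by measurable
      from measurable_compose[OF this borel_measurable_indicator[OF A]]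
      have [measurable]: "(\<lambda>p. indicator A (fst p, S2 (fst p) (snd p)) :: ennreal) \<in> borel_measurable ?N" .
      have "emeasure (distr ?N ?N S) A = (\<integral>\<^sup>+p. indicator A p \<partial>distr ?N ?N S)"
        using A by simp
      also have "\<dots> = (\<integral>\<^sup>+p. indicator A (S p) \<partial>?N)" by (rule nn_integral_distr) measurable
      also have "\<dots> = (\<integral>\<^sup>+x. \<integral>\<^sup>+t. indicator A (S (x, t)) \<partial>gauss_line \<partial>M)"
        by (rule G.nn_integral_fst[symmetric]) measurable
      also have "\<dots> = (\<integral>\<^sup>+x. ennreal (F x) * (\<integral>\<^sup>+t. indicator A (x, S2 x t) \<partial>gauss_line) \<partial>M)"
        unfolding S_def fst_conv snd_conv
        by (rule push1'[of "\<lambda>x. \<integral>\<^sup>+t. indicator A (x, S2 x t) \<partial>gauss_line"])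
          (rule G.borel_measurable_nn_integral, simp add: case_prod_beta')
      also have "\<dots> = (\<integral>\<^sup>+x. ennreal (F x) * (\<integral>\<^sup>+t. ennreal (c x t) * indicator A (x, t) \<partial>gauss_line) \<partial>M)"
      proof (rule nn_integral_cong)
        fix x assume x: "x \<in> space M"
        have "(\<lambda>t. indicator A (x, t) :: ennreal) \<in> borel_measurable borel"
          using measurable_compose[OF measurable_Pair1'[OF x] borel_measurable_indicator[OF A]] by simp
        then show "ennreal (F x) * (\<integral>\<^sup>+t. indicator A (x, S2 x t) \<partial>gauss_line)
            = ennreal (F x) * (\<integral>\<^sup>+t. ennreal (c x t) * indicator A (x, t) \<partial>gauss_line)"
          by (simp add: push2[OF x, of "\<lambda>t. indicator A (x, t)"])
      qed
      also have "\<dots> = (\<integral>\<^sup>+p. ennreal (f p) * indicator A p \<partial>?N)"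
        by (rule split[symmetric]) measurable
      also have "\<dots> = emeasure (density ?N (\<lambda>p. ennreal (f p))) A"
        by (rule emeasure_density[OF _ A, symmetric]) measurable
      finally show "emeasure (distr ?N ?N S) A = emeasure (density ?N (\<lambda>p. ennreal (f p))) A" .
    qed simp
    \<comment> \<open>on the fibres the remainder term is dropped\<close>
    have fibre: "(\<integral>\<^sup>+t. ennreal ((S2 x t - t)\<^sup>2) \<partial>gauss_line)
        \<le> 2 * (\<integral>\<^sup>+t. ennreal (entropy_gap (c x t)) \<partial>gauss_line)" if x: "x \<in> space M" for x
    proof -
      have "u x t / std_normal_density t = c x t" for t
        by (simp add: u_def normal_density_pos[THEN less_imp_neq, symmetric])
      then show ?thesis
        using order_trans[OF add_increasing2[OF zero_le order_refl] talagrand_line[OF u_dens[OF x]]]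
        by (simp add: S2_def)
    qed
    have J2 [measurable]: "(\<lambda>x. \<integral>\<^sup>+t. ennreal (entropy_gap (c x t)) \<partial>gauss_line) \<in> borel_measurable M"
      by (rule G.borel_measurable_nn_integral) (simp add: case_prod_beta')
    have "(\<integral>\<^sup>+p. ennreal (cost (fst p) (fst (S p)) + (snd (S p) - snd p)\<^sup>2) \<partial>?N)
        = (\<integral>\<^sup>+p. ennreal (cost (fst p) (S1 (fst p))) + ennreal ((S2 (S1 (fst p)) (snd p) - snd p)\<^sup>2) \<partial>?N)"
      using cost_nonneg by (simp add: S_def ennreal_plus)
    also have "\<dots> = (\<integral>\<^sup>+p. ennreal (cost (fst p) (S1 (fst p))) \<partial>?N)
        + (\<integral>\<^sup>+p. ennreal ((S2 (S1 (fst p)) (snd p) - snd p)\<^sup>2) \<partial>?N)"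
      by (rule nn_integral_add) measurable
    also have "(\<integral>\<^sup>+p. ennreal (cost (fst p) (S1 (fst p))) \<partial>?N) = (\<integral>\<^sup>+x. ennreal (cost x (S1 x)) \<partial>M)"
      using G.emeasure_space_1 by (subst G.nn_integral_fst[symmetric]) auto
    also have "(\<integral>\<^sup>+p. ennreal ((S2 (S1 (fst p)) (snd p) - snd p)\<^sup>2) \<partial>?N)
        = (\<integral>\<^sup>+x. \<integral>\<^sup>+t. ennreal ((S2 (S1 x) t - t)\<^sup>2) \<partial>gauss_line \<partial>M)"
      by (subst G.nn_integral_fst[symmetric]) auto
    also have "\<dots> = (\<integral>\<^sup>+x. ennreal (F x) * (\<integral>\<^sup>+t. ennreal ((S2 x t - t)\<^sup>2) \<partial>gauss_line) \<partial>M)"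
      by (rule push1'[of "\<lambda>x. \<integral>\<^sup>+t. ennreal ((S2 x t - t)\<^sup>2) \<partial>gauss_line"])
        (rule G.borel_measurable_nn_integral, simp add: case_prod_beta')
    also have "\<dots> \<le> (\<integral>\<^sup>+x. ennreal (F x) * (2 * (\<integral>\<^sup>+t. ennreal (entropy_gap (c x t)) \<partial>gauss_line)) \<partial>M)"
      by (intro nn_integral_mono mult_left_mono fibre) auto
    also have "\<dots> = 2 * (\<integral>\<^sup>+x. ennreal (F x) * (\<integral>\<^sup>+t. ennreal (entropy_gap (c x t)) \<partial>gauss_line) \<partial>M)"
      by (subst nn_integral_cmult[symmetric]) (auto simp: mult.left_commute)
    finally have "(\<integral>\<^sup>+p. ennreal (cost (fst p) (fst (S p)) + (snd (S p) - snd p)\<^sup>2) \<partial>?N) + D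
       \<le> ((\<integral>\<^sup>+x. ennreal (cost x (S1 x)) \<partial>M) + D)
         + 2 * (\<integral>\<^sup>+x. ennreal (F x) * (\<integral>\<^sup>+t. ennreal (entropy_gap (c x t)) \<partial>gauss_line) \<partial>M)"
      by (simp add: ac_simps add_left_mono)
    also have "\<dots> \<le> 2 * (\<integral>\<^sup>+x. ennreal (entropy_gap (F x)) \<partial>M)
         + 2 * (\<integral>\<^sup>+x. ennreal (F x) * (\<integral>\<^sup>+t. ennreal (entropy_gap (c x t)) \<partial>gauss_line) \<partial>M)"
      by (intro add_right_mono bound1)
    also have "\<dots> = 2 * (\<integral>\<^sup>+x. ennreal (entropy_gap (F x))
         + ennreal (F x) * (\<integral>\<^sup>+t. ennreal (entropy_gap (c x t)) \<partial>gauss_line) \<partial>M)"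
      by (subst nn_integral_add) (auto simp: distrib_left)
    also have "\<dots> \<le> 2 * (\<integral>\<^sup>+x. \<integral>\<^sup>+t. ennreal (entropy_gap (f (x, t))) \<partial>gauss_line \<partial>M)"
    proof (intro mult_left_mono nn_integral_mono_AE)
      have "AE x in M. x \<in> space M" by (rule AE_space)
      with eq show "AE x in M. ennreal (entropy_gap (F x))
         + ennreal (F x) * (\<integral>\<^sup>+t. ennreal (entropy_gap (c x t)) \<partial>gauss_line)
         \<le> (\<integral>\<^sup>+t. ennreal (entropy_gap (f (x, t))) \<partial>gauss_line)"
      proof eventually_elim
        case (elim x)
        then show ?case using G.entropy_gap_scale[of "c x" "F x"] c0 c1 F0 by simp
      qed
    qed simp
    also have "(\<integral>\<^sup>+x. \<integral>\<^sup>+t. ennreal (entropy_gap (f (x, t))) \<partial>gauss_line \<partial>M)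
        = (\<integral>\<^sup>+p. ennreal (entropy_gap (f p)) \<partial>?N)"
      by (rule G.nn_integral_fst) measurable
    finally show "(\<integral>\<^sup>+p. ennreal (cost (fst p) (fst (S p)) + (snd (S p) - snd p)\<^sup>2) \<partial>?N) + D
        \<le> 2 * (\<integral>\<^sup>+p. ennreal (entropy_gap (f p)) \<partial>?N)" .
  qed
qed

section \<open>Knothe's map for Gaussian products\<close>

text \<open>The base of the induction. The density \<open>g\<close> is known only through its law, hence it equals
  \<open>u / \<phi>\<close> almost everywhere.\<close>

lemma transport_bound_gauss_line:
  assumes g [measurable]: "g \<in> borel_measurable borel" and u: "pos_density u"
    and law: "density gauss_line (\<lambda>t. ennreal (g t)) = density lborel (\<lambda>x. ennreal (u x))"
    and g0: "\<And>t. 0 < g t"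
  shows "transport_bound gauss_line (\<lambda>x y. (y - x)\<^sup>2)
    (\<integral>\<^sup>+y. ennreal (2 * log_gap (transport_slope std_normal_density u y)) \<partial>gauss_line) g"
proof -
  let ?S = "monotone_transport std_normal_density u"
  note n = pos_density_std_normal
  note [measurable] = pos_density_measurable[OF u] measurable_monotone_transport[OF n u]
  have "density lborel (\<lambda>t. ennreal (std_normal_density t * g t)) = density lborel (\<lambda>x. ennreal (u x))"
    using law g0 by (simp add: density_density_eq ennreal_mult less_imp_le)
  then have "AE t in lborel. ennreal (std_normal_density t * g t) = ennreal (u t)"
    by (subst (asm) sigma_finite_measure.density_unique_iff[OF sigma_finite_lborel]) auto
  then have "AE t in lborel. g t = u t / std_normal_density t"
  proof eventually_elim
    case (elim t)
    then have "std_normal_density t * g t = u t"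
      using g0[of t] pos_density_pos[OF u, of t] by (simp add: less_imp_le)
    then show ?case using normal_density_pos[of 1 0 t] by (simp add: field_simps)
  qed
  then have "AE t in gauss_line. g t = u t / std_normal_density t"
    by (auto simp: AE_density)
  then have entropy: "(\<integral>\<^sup>+t. ennreal (entropy_gap (g t)) \<partial>gauss_line)
      = (\<integral>\<^sup>+t. ennreal (entropy_gap (u t / std_normal_density t)) \<partial>gauss_line)"
    by (intro nn_integral_cong_AE) auto
  show ?thesis
    unfolding transport_bound_def
  proof (intro bexI conjI)
    show "?S \<in> measurable gauss_line gauss_line" by simp
    have "distr gauss_line gauss_line ?S = distr gauss_line borel ?S"
      by (rule distr_cong) auto
    then show "distr gauss_line gauss_line ?S = density gauss_line (\<lambda>t. ennreal (g t))"
      by (simp add: distr_monotone_transport[OF n u] law)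
    show "(\<integral>\<^sup>+x. ennreal ((?S x - x)\<^sup>2) \<partial>gauss_line)
        + (\<integral>\<^sup>+y. ennreal (2 * log_gap (transport_slope std_normal_density u y)) \<partial>gauss_line)
        \<le> 2 * (\<integral>\<^sup>+x. ennreal (entropy_gap (g x)) \<partial>gauss_line)"
      using talagrand_line[OF u] by (simp add: entropy)
  qed
qed

text \<open>Transport bounds move along measure preserving isomorphisms by conjugating the map. This serves
  to identify products with function spaces and to rotate coordinates.\<close>

lemma transport_bound_iso:
  assumes e [measurable]: "e \<in> measurable M N" and r [measurable]: "r \<in> measurable N M"
    and inv: "\<And>x. x \<in> space M \<Longrightarrow> r (e x) = x" and push: "distr M N e = N"
    and cost: "\<And>x y. x \<in> space M \<Longrightarrow> y \<in> space M \<Longrightarrow> cost' (e x) (e y) = cost x y"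
    and cost' [measurable]: "case_prod cost' \<in> borel_measurable (N \<Otimes>\<^sub>M N)"
    and f [measurable]: "f \<in> borel_measurable N"
    and bound: "transport_bound M cost D (\<lambda>x. f (e x))"
  shows "transport_bound N cost' D f"
proof -
  from bound obtain S where S [measurable]: "S \<in> measurable M M"
    and pushS: "distr M M S = density M (\<lambda>x. ennreal (f (e x)))"
    and le: "(\<integral>\<^sup>+x. ennreal (cost x (S x)) \<partial>M) + D \<le> 2 * (\<integral>\<^sup>+x. ennreal (entropy_gap (f (e x))) \<partial>M)"
    by (auto simp: transport_bound_def)
  have Sx: "S x \<in> space M" if "x \<in> space M" for x using measurable_space[OF S that] .
  let ?S = "\<lambda>y. e (S (r y))"
  have S': "?S \<in> measurable N N" by measurable
  have nn: "(\<integral>\<^sup>+y. g y \<partial>N) = (\<integral>\<^sup>+x. g (e x) \<partial>M)" if "g \<in> borel_measurable N" for g :: "_ \<Rightarrow> ennreal"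
    using that by (subst push[symmetric]) (simp add: nn_integral_distr)
  show ?thesis
    unfolding transport_bound_def
  proof (intro bexI conjI)
    show "?S \<in> measurable N N" by (rule S')
    have "distr N N ?S = distr (distr M N e) N ?S" by (simp add: push)
    also have "\<dots> = distr M N (?S \<circ> e)" by (rule distr_distr) measurable
    also have "\<dots> = distr M N (e \<circ> S)" by (rule distr_cong) (auto simp: inv)
    also have "\<dots> = distr (distr M M S) N e" by (rule distr_distr[symmetric]) measurable
    also have "\<dots> = density (distr M N e) (\<lambda>y. ennreal (f y))"
      unfolding pushS by (rule density_distr[symmetric]) measurable
    finally show "distr N N ?S = density N (\<lambda>y. ennreal (f y))" by (simp add: push)
    have "(\<lambda>y. cost' y (?S y)) \<in> borel_measurable N"
      using measurable_compose[OF measurable_Pair[OF measurable_ident_sets[OF refl] S'] cost'] by simp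
    then have "(\<integral>\<^sup>+y. ennreal (cost' y (?S y)) \<partial>N) = (\<integral>\<^sup>+x. ennreal (cost' (e x) (?S (e x))) \<partial>M)"
      by (intro nn) simp
    also have "\<dots> = (\<integral>\<^sup>+x. ennreal (cost x (S x)) \<partial>M)"
      by (rule nn_integral_cong) (simp add: inv cost Sx)
    finally show "(\<integral>\<^sup>+y. ennreal (cost' y (?S y)) \<partial>N) + D \<le> 2 * (\<integral>\<^sup>+y. ennreal (entropy_gap (f y)) \<partial>N)"
      using le by (simp add: nn)
  qed
qed

abbreviation gauss_product :: "'i set \<Rightarrow> ('i \<Rightarrow> real) measure" where
  "gauss_product I \<equiv> PiM I (\<lambda>_. gauss_line)"

interpretation gauss_line: product_sigma_finite "\<lambda>_. gauss_line"
  by (simp add: product_sigma_finite_def prob_space_gauss_line prob_space_imp_sigma_finite)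

lemma prob_space_gauss_product: "prob_space (gauss_product I)"
  by (intro prob_space_PiM prob_space_gauss_line)

lemma distr_gauss_product_insert:
  assumes "finite I" "i \<notin> I"
  shows "distr (gauss_product I \<Otimes>\<^sub>M gauss_line) (gauss_product (insert i I)) (\<lambda>p. (fst p)(i := snd p))
       = gauss_product (insert i I)"
proof (rule measure_eqI)
  have m [measurable]: "(\<lambda>p. (fst p)(i := snd p)) \<in> measurable (gauss_product I \<Otimes>\<^sub>M gauss_line) (gauss_product (insert i I))"
    using measurable_add_dim[of i I "\<lambda>_. gauss_line"] by (simp add: case_prod_beta')
  fix A assume "A \<in> sets (distr (gauss_product I \<Otimes>\<^sub>M gauss_line) (gauss_product (insert i I)) (\<lambda>p. (fst p)(i := snd p)))"
  then have A [measurable]: "A \<in> sets (gauss_product (insert i I))" by simp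
  let ?D = "distr (gauss_product I \<Otimes>\<^sub>M gauss_line) (gauss_product (insert i I)) (\<lambda>p. (fst p)(i := snd p))"
  have "emeasure ?D A = (\<integral>\<^sup>+x. indicator A x \<partial>?D)" using A by simp
  also have "\<dots> = (\<integral>\<^sup>+p. indicator A ((fst p)(i := snd p)) \<partial>(gauss_product I \<Otimes>\<^sub>M gauss_line))"
    by (rule nn_integral_distr[OF m]) simp
  also have "\<dots> = (\<integral>\<^sup>+x. \<integral>\<^sup>+t. indicator A (x(i := t)) \<partial>gauss_line \<partial>gauss_product I)"
    by (rule sigma_finite_measure.nn_integral_fst[symmetric, where f = "\<lambda>p. indicator A ((fst p)(i := snd p))", simplified])
      (auto intro: prob_space_imp_sigma_finite prob_space_gauss_line)
  also have "\<dots> = (\<integral>\<^sup>+x. indicator A x \<partial>gauss_product (insert i I))"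
    by (rule gauss_line.product_nn_integral_insert[symmetric]) (use assms in auto)
  also have "\<dots> = emeasure (gauss_product (insert i I)) A" by simp
  finally show "emeasure ?D A = emeasure (gauss_product (insert i I)) A" .
qed simp

text \<open>Induction over the coordinates, starting from the distinguished coordinate \<open>i0\<close>. Its
  marginal density \<open>u\<close> never changes, because each step only integrates out another coordinate.\<close>

lemma transport_bound_gauss_product:
  fixes f :: "('i \<Rightarrow> real) \<Rightarrow> real"
  assumes u: "pos_density u" and "finite I" "i0 \<notin> I"
    and "f \<in> borel_measurable (gauss_product (insert i0 I))" "\<And>x. 0 < f x"
    and "distr (density (gauss_product (insert i0 I)) (\<lambda>x. ennreal (f x))) borel (\<lambda>x. x i0)
       = density lborel (\<lambda>x. ennreal (u x))"
  shows "transport_bound (gauss_product (insert i0 I)) (\<lambda>x y. \<Sum>i\<in>insert i0 I. (y i - x i)\<^sup>2)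
    (\<integral>\<^sup>+y. ennreal (2 * log_gap (transport_slope std_normal_density u y)) \<partial>gauss_line) f"
  using assms(2-)
proof (induction I arbitrary: f rule: finite_induct)
  case empty
  note f [measurable] = empty(2)
  let ?N = "gauss_product {i0}" and ?e = "\<lambda>t. \<lambda>i\<in>{i0}. t"
  have e [measurable]: "?e \<in> measurable gauss_line ?N" by (rule measurable_restrict) simp
  have push: "distr gauss_line ?N ?e = ?N" by (rule gauss_line.distr_component)
  show ?case
  proof (rule transport_bound_iso[where e = ?e and r = "\<lambda>x. x i0" and M = gauss_line])
    have "distr (density gauss_line (\<lambda>t. ennreal (f (?e t)))) ?N ?e = density (distr gauss_line ?N ?e) (\<lambda>x. ennreal (f x))"
      by (rule density_distr[OF _ e, symmetric]) (use f in simp)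
    then have "distr (density ?N (\<lambda>x. ennreal (f x))) borel (\<lambda>x. x i0)
        = distr (distr (density gauss_line (\<lambda>t. ennreal (f (?e t)))) ?N ?e) borel (\<lambda>x. x i0)"
      by (simp add: push)
    also have "\<dots> = distr (density gauss_line (\<lambda>t. ennreal (f (?e t)))) borel ((\<lambda>x. x i0) \<circ> ?e)"
      by (rule distr_distr) (use e in simp_all)
    also have "\<dots> = density gauss_line (\<lambda>t. ennreal (f (?e t)))"
      by (simp add: comp_def distr_id2)
    finally have "density gauss_line (\<lambda>t. ennreal (f (?e t))) = density lborel (\<lambda>x. ennreal (u x))"
      using empty by simp
    then show "transport_bound gauss_line (\<lambda>x y. (y - x)\<^sup>2)
      (\<integral>\<^sup>+y. ennreal (2 * log_gap (transport_slope std_normal_density u y)) \<partial>gauss_line) (\<lambda>t. f (?e t))"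
      using empty(3) u measurable_compose[OF e f]
      by (intro transport_bound_gauss_line) auto
    show "case_prod (\<lambda>x y. \<Sum>i\<in>{i0}. (y i - x i)\<^sup>2) \<in> borel_measurable (?N \<Otimes>\<^sub>M ?N)"
      by (simp add: case_prod_beta')
    show "f \<in> borel_measurable ?N" by (rule f)
    show "?e \<in> measurable gauss_line ?N" by (rule e)
    show "distr gauss_line ?N ?e = ?N" by (rule push)
  qed auto
next
  case (insert j I)
  note f [measurable] = insert.prems(2)
  let ?J = "insert i0 I"
  let ?M = "gauss_product ?J" and ?N = "gauss_product (insert j ?J)"
  let ?e = "\<lambda>p. (fst p)(j := snd p)" and ?r = "\<lambda>x. (restrict x ?J, x j)"
  have j: "j \<notin> ?J" and fin: "finite ?J" and i0: "i0 \<noteq> j" "i0 \<in> ?J" using insert by auto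
  have [simp]: "insert i0 (insert j I) = insert j ?J" by auto
  have e [measurable]: "?e \<in> measurable (?M \<Otimes>\<^sub>M gauss_line) ?N"
    using measurable_add_dim[of j ?J "\<lambda>_. gauss_line"] by (simp add: case_prod_beta')
  have push: "distr (?M \<Otimes>\<^sub>M gauss_line) ?N ?e = ?N"
    by (rule distr_gauss_product_insert[OF fin j])
  have fN [measurable]: "f \<in> borel_measurable ?N" using f by simp
  have fe: "(\<lambda>p. f (?e p)) \<in> borel_measurable (?M \<Otimes>\<^sub>M gauss_line)" by measurable
  have "(\<integral>\<^sup>+x. ennreal (f x) \<partial>?N) = emeasure (density ?N (\<lambda>x. ennreal (f x))) (space ?N)"
    by (subst emeasure_density) (auto intro!: nn_integral_cong)
  also have "\<dots> = emeasure (distr (density ?N (\<lambda>x. ennreal (f x))) borel (\<lambda>x. x i0)) UNIV"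
    using i0 by (subst emeasure_distr) auto
  also have "\<dots> = 1"
    unfolding insert.prems(4)[simplified] using u
    by (subst emeasure_density) (auto simp: pos_density_def)
  finally have total: "(\<integral>\<^sup>+x. ennreal (f x) \<partial>?N) = 1" .
  have total': "(\<integral>\<^sup>+p. ennreal (f (?e p)) \<partial>(?M \<Otimes>\<^sub>M gauss_line)) = 1"
    using total by (subst (asm) push[symmetric]) (simp add: nn_integral_distr)
  show ?case
    unfolding \<open>insert i0 (insert j I) = insert j ?J\<close>
  proof (rule transport_bound_iso[where e = ?e and r = ?r, OF e _ _ push])
    show "?r \<in> measurable ?N (?M \<Otimes>\<^sub>M gauss_line)" by measurable
    show "?r (?e p) = p" if "p \<in> space (?M \<Otimes>\<^sub>M gauss_line)" for p
      using that j by (auto simp: space_pair_measure space_PiM fun_eq_iff PiE_def extensional_def restrict_def)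
    show "transport_bound (?M \<Otimes>\<^sub>M gauss_line)
      (\<lambda>p q. (\<Sum>i\<in>?J. (fst q i - fst p i)\<^sup>2) + (snd q - snd p)\<^sup>2)
      (\<integral>\<^sup>+y. ennreal (2 * log_gap (transport_slope std_normal_density u y)) \<partial>gauss_line) (\<lambda>p. f (?e p))"
    proof (rule transport_bound_Times_gauss[where cost = "\<lambda>x y. \<Sum>i\<in>?J. (y i - x i)\<^sup>2"])
      show "prob_space ?M" by (rule prob_space_gauss_product)
      fix F :: "('i \<Rightarrow> real) \<Rightarrow> real"
      assume F: "F \<in> borel_measurable ?M" "\<And>x. 0 < F x"
        and law: "density ?M (\<lambda>x. ennreal (F x)) = distr (density (?M \<Otimes>\<^sub>M gauss_line) (\<lambda>p. ennreal (f (?e p)))) ?M fst"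
      have "distr (density ?M (\<lambda>x. ennreal (F x))) borel (\<lambda>x. x i0)
          = distr (density (?M \<Otimes>\<^sub>M gauss_line) (\<lambda>p. ennreal (f (?e p)))) borel ((\<lambda>x. x i0) \<circ> fst)"
        unfolding law by (rule distr_distr) auto
      also have "\<dots> = distr (density (?M \<Otimes>\<^sub>M gauss_line) (\<lambda>p. ennreal (f (?e p)))) borel ((\<lambda>x. x i0) \<circ> ?e)"
        using i0 by (intro distr_cong) auto
      also have "\<dots> = distr (distr (density (?M \<Otimes>\<^sub>M gauss_line) (\<lambda>p. ennreal (f (?e p)))) ?N ?e) borel (\<lambda>x. x i0)"
        by (rule distr_distr[symmetric]) (use e i0 in simp_all)
      also have "distr (density (?M \<Otimes>\<^sub>M gauss_line) (\<lambda>p. ennreal (f (?e p)))) ?N ?e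
          = density (distr (?M \<Otimes>\<^sub>M gauss_line) ?N ?e) (\<lambda>x. ennreal (f x))"
        by (rule density_distr[OF _ e, symmetric]) (use fN in simp)
      also have "distr \<dots> borel (\<lambda>x. x i0) = density lborel (\<lambda>x. ennreal (u x))"
        using insert.prems(4) by (simp add: push)
      finally show "transport_bound ?M (\<lambda>x y. \<Sum>i\<in>?J. (y i - x i)\<^sup>2)
        (\<integral>\<^sup>+y. ennreal (2 * log_gap (transport_slope std_normal_density u y)) \<partial>gauss_line) F"
        using insert F by (intro insert.IH) auto
    qed (use fe total' insert.prems in \<open>auto simp: sum_nonneg case_prod_beta'\<close>)
    show "(\<Sum>i\<in>insert j ?J. (?e q i - ?e p i)\<^sup>2) = (\<Sum>i\<in>?J. (fst q i - fst p i)\<^sup>2) + (snd q - snd p)\<^sup>2" for p q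
    proof -
      have "(\<Sum>i\<in>?J. (?e q i - ?e p i)\<^sup>2) = (\<Sum>i\<in>?J. (fst q i - fst p i)\<^sup>2)"
        using j by (intro sum.cong) auto
      then show ?thesis using j fin by (subst sum.insert) (auto simp: add.commute)
    qed
    show "(\<lambda>(x, y). \<Sum>i\<in>insert j ?J. (y i - x i)\<^sup>2) \<in> borel_measurable (?N \<Otimes>\<^sub>M ?N)"
      by (simp add: case_prod_beta')
  qed (rule fN)
qed

section \<open>Translation invariant measures\<close>

text \<open>Uniqueness of Haar measure by the classical double use of Fubini: integrate \<open>g y * f (e x + y)\<close>,
  where the window \<open>g\<close> has Lebesgue mass 1, in both orders. One order uses the invariance of \<open>M\<close> and the
  other that of Lebesgue measure. Invariance of the image of \<open>M\<close> under the coordinate map \<open>e\<close> is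
  expressed through integrals over \<open>M\<close>, because the image itself need not be sigma-finite a priori.\<close>

lemma translation_invariant_unique:
  fixes e :: "'a \<Rightarrow> 'b::euclidean_space"
  assumes M: "sigma_finite_measure M" and e [measurable]: "e \<in> borel_measurable M"
    and inv: "\<And>(g :: 'b \<Rightarrow> ennreal) v. g \<in> borel_measurable borel \<Longrightarrow>
      (\<integral>\<^sup>+x. g (e x + v) \<partial>M) = (\<integral>\<^sup>+x. g (e x) \<partial>M)"
  obtains C :: ennreal where
    "\<And>f. f \<in> borel_measurable borel \<Longrightarrow> (\<integral>\<^sup>+x. f (e x) \<partial>M) = C * (\<integral>\<^sup>+x. f x \<partial>lborel)"
proof -
  interpret M: sigma_finite_measure M by fact
  interpret pair_sigma_finite M "lborel :: 'b measure" by standard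
  define g :: "'b \<Rightarrow> ennreal" where "g = indicator (box 0 One)"
  have g [measurable]: "g \<in> borel_measurable borel" unfolding g_def by simp
  have g1: "(\<integral>\<^sup>+x. g x \<partial>lborel) = 1"
    by (simp add: g_def emeasure_lborel_box_eq)
  show ?thesis
  proof
    fix f :: "'b \<Rightarrow> ennreal" assume f [measurable]: "f \<in> borel_measurable borel"
    have shift: "(\<integral>\<^sup>+y. h (y + v) \<partial>lborel) = (\<integral>\<^sup>+y. h y \<partial>lborel)"
      if "h \<in> borel_measurable borel" for h :: "'b \<Rightarrow> ennreal" and v
      using that by (subst (2) lborel_distr_plus[of v, symmetric]) (simp add: nn_integral_distr add.commute)
    have "(\<integral>\<^sup>+x. f (e x) \<partial>M) = (\<integral>\<^sup>+y. g y * (\<integral>\<^sup>+x. f (e x) \<partial>M) \<partial>lborel)"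
      by (simp add: nn_integral_multc g1)
    also have "\<dots> = (\<integral>\<^sup>+y. \<integral>\<^sup>+x. g y * f (e x + y) \<partial>M \<partial>lborel)"
      by (simp add: nn_integral_cmult inv)
    also have "\<dots> = (\<integral>\<^sup>+x. \<integral>\<^sup>+y. g y * f (e x + y) \<partial>lborel \<partial>M)"
      using Fubini[of "\<lambda>(x, y). g y * f (e x + y)"] by (simp add: case_prod_beta')
    also have "\<dots> = (\<integral>\<^sup>+x. \<integral>\<^sup>+y. g (y - e x) * f y \<partial>lborel \<partial>M)"
    proof (rule nn_integral_cong)
      fix x
      have "(\<integral>\<^sup>+y. g ((y + e x) - e x) * f (y + e x) \<partial>lborel) = (\<integral>\<^sup>+y. g (y - e x) * f y \<partial>lborel)"
        by (rule shift[of "\<lambda>y. g (y - e x) * f y"]) simp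
      then show "(\<integral>\<^sup>+y. g y * f (e x + y) \<partial>lborel) = (\<integral>\<^sup>+y. g (y - e x) * f y \<partial>lborel)"
        by (simp add: add.commute)
    qed
    also have "\<dots> = (\<integral>\<^sup>+y. \<integral>\<^sup>+x. g (y - e x) * f y \<partial>M \<partial>lborel)"
      using Fubini[of "\<lambda>(x, y). g (y - e x) * f y"] by (simp add: case_prod_beta')
    also have "\<dots> = (\<integral>\<^sup>+y. (\<integral>\<^sup>+x. g (- e x) \<partial>M) * f y \<partial>lborel)"
    proof (rule nn_integral_cong)
      fix y
      show "(\<integral>\<^sup>+x. g (y - e x) * f y \<partial>M) = (\<integral>\<^sup>+x. g (- e x) \<partial>M) * f y"
        using inv[of "\<lambda>z. g (- z)" "- y"] by (simp add: nn_integral_multc)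
    qed
    also have "\<dots> = (\<integral>\<^sup>+x. g (- e x) \<partial>M) * (\<integral>\<^sup>+y. f y \<partial>lborel)"
      by (rule nn_integral_cmult) simp
    finally show "(\<integral>\<^sup>+x. f (e x) \<partial>M) = (\<integral>\<^sup>+x. g (- e x) \<partial>M) * (\<integral>\<^sup>+x. f x \<partial>lborel)" .
  qed
qed

section \<open>Gaussian measure in an orthonormal basis\<close>

definition orthonormal_basis :: "(real ^ 'n) set \<Rightarrow> bool" where
  "orthonormal_basis B \<longleftrightarrow> finite B \<and> card B = CARD('n) \<and> span B = UNIV \<and>
    pairwise orthogonal B \<and> (\<forall>b\<in>B. norm b = 1)"

definition basis_vector :: "(real ^ 'n) set \<Rightarrow> (real ^ 'n \<Rightarrow> real) \<Rightarrow> real ^ 'n" where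
  "basis_vector B z = (\<Sum>b\<in>B. z b *\<^sub>R b)"

lemma orthonormal_basis_exists:
  fixes \<xi> :: "real ^ 'n" assumes "norm \<xi> = 1"
  obtains B where "\<xi> \<in> B" "orthonormal_basis B"
proof -
  obtain S where "\<xi> \<in> S" "pairwise orthogonal S" "\<And>x. x \<in> S \<Longrightarrow> norm x = 1"
    "independent S" "card S = DIM(real ^ 'n)" "span S = UNIV"
    by (rule vector_in_orthonormal_basis[OF assms]) blast
  then show ?thesis
    using that[of S] by (auto simp: orthonormal_basis_def independent_imp_finite)
qed

lemma measurable_gauss_density [measurable]: "gauss_density \<in> borel_measurable borel"
  unfolding gauss_density_def[abs_def] by measurable

lemma gauss_density_pos: "0 < gauss_density x"
  by (simp add: gauss_density_def)

context
  fixes B :: "(real ^ 'n) set" assumes B: "orthonormal_basis B"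
begin

lemma orthonormal_basis_finite: "finite B"
  using B by (simp add: orthonormal_basis_def)

lemma orthonormal_basis_inner:
  "b \<in> B \<Longrightarrow> c \<in> B \<Longrightarrow> b \<bullet> c = (if b = c then 1 else 0)"
  using B by (auto simp: orthonormal_basis_def pairwise_def orthogonal_def norm_eq_1)

lemma inner_basis_vector: "c \<in> B \<Longrightarrow> basis_vector B z \<bullet> c = z c"
  using orthonormal_basis_finite
  by (simp add: basis_vector_def inner_sum_left orthonormal_basis_inner if_distrib cong: if_cong)

lemma norm_basis_vector_diff: "(norm (basis_vector B z - basis_vector B z'))\<^sup>2 = (\<Sum>b\<in>B. (z b - z' b)\<^sup>2)"
proof -
  have "basis_vector B z - basis_vector B z' = basis_vector B (\<lambda>b. z b - z' b)"
    by (simp add: basis_vector_def scaleR_left_diff_distrib sum_subtractf)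
  moreover have "(norm (basis_vector B y))\<^sup>2 = (\<Sum>b\<in>B. (y b)\<^sup>2)" for y
  proof -
    have "(norm (basis_vector B y))\<^sup>2 = basis_vector B y \<bullet> (\<Sum>b\<in>B. y b *\<^sub>R b)"
      by (simp add: power2_norm_eq_inner flip: basis_vector_def)
    then show ?thesis by (simp add: inner_sum_right inner_basis_vector power2_eq_square)
  qed
  ultimately show ?thesis by simp
qed

lemma basis_vector_inner: "basis_vector B (\<lambda>b. x \<bullet> b) = x"
  unfolding basis_vector_def
  using B by (intro orthonormal_basis_expand) (auto simp: orthonormal_basis_def)

lemma gauss_density_basis_vector:
  "gauss_density (basis_vector B z) = (\<Prod>b\<in>B. std_normal_density (z b))"
proof -
  have "(2 * pi) powr (- real CARD('n) / 2) = ((2 * pi) powr (- 1 / 2)) ^ CARD('n)"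
    by (simp add: powr_realpow[symmetric] powr_powr)
  also have "(2 * pi) powr (- 1 / 2) = 1 / sqrt (2 * pi)"
    by (simp add: powr_half_sqrt powr_minus_divide)
  finally have const: "(2 * pi) powr (- real CARD('n) / 2) = (1 / sqrt (2 * pi)) ^ card B"
    using B by (simp add: orthonormal_basis_def)
  have "norm (basis_vector B z) ^ 2 = (\<Sum>b\<in>B. (z b)\<^sup>2)"
    using norm_basis_vector_diff[of z "\<lambda>_. 0"] by (simp add: basis_vector_def)
  then have "exp (- (norm (basis_vector B z))\<^sup>2 / 2) = (\<Prod>b\<in>B. exp (- (z b)\<^sup>2 / 2))"
    using orthonormal_basis_finite
    by (simp add: exp_sum[symmetric] sum_negf sum_divide_distrib)
  then show ?thesis
    by (simp only: gauss_density_def const std_normal_density_def prod.distrib prod_constant)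
qed

lemma measurable_basis_vector [measurable]:
  "(\<And>i. sets (M i) = sets borel) \<Longrightarrow> basis_vector B \<in> borel_measurable (PiM B M)"
  unfolding basis_vector_def[abs_def]
  by (intro borel_measurable_sum borel_measurable_scaleR borel_measurable_const)
    (metis measurable_component_singleton measurable_cong_sets)

end

lemma orthonormal_basis_Basis: "orthonormal_basis (Basis :: (real ^ 'n) set)"
  by (auto simp: orthonormal_basis_def pairwise_def orthogonal_def inner_Basis)

lemma nn_integral_gauss_density: "(\<integral>\<^sup>+x. ennreal (gauss_density x) \<partial>(lborel :: (real ^ 'n) measure)) = 1"
proof -
  let ?B = "Basis :: (real ^ 'n) set"
  have "gauss_density x = (\<Prod>b\<in>?B. std_normal_density (x \<bullet> b))" for x :: "real ^ 'n"
    using gauss_density_basis_vector[OF orthonormal_basis_Basis, of "\<lambda>b. x \<bullet> b"]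
    by (simp add: basis_vector_inner[OF orthonormal_basis_Basis])
  then have "(\<integral>\<^sup>+x. ennreal (gauss_density x) \<partial>(lborel :: (real ^ 'n) measure))
      = (\<integral>\<^sup>+x. (\<Prod>b\<in>?B. ennreal (std_normal_density (x \<bullet> b))) \<partial>lborel)"
    by (simp add: prod_ennreal)
  also have "\<dots> = (\<Prod>b\<in>?B. \<integral>\<^sup>+x. ennreal (std_normal_density x) \<partial>lborel)"
    by (rule nn_integral_lborel_prod) auto
  finally show ?thesis
    by (simp add: pos_density_nn_integral[OF pos_density_std_normal])
qed

context
  fixes B :: "(real ^ 'n) set" assumes B: "orthonormal_basis B"
begin

interpretation lborel_product: product_sigma_finite "\<lambda>_. lborel :: real measure"
  by (simp add: product_sigma_finite_def sigma_finite_lborel)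

lemma distr_PiM_lborel_translate:
  fixes a :: "real ^ 'n \<Rightarrow> real"
  shows "distr (PiM B (\<lambda>_. lborel)) (PiM B (\<lambda>_. lborel)) (\<lambda>z. \<lambda>b\<in>B. z b + a b) = PiM B (\<lambda>_. lborel)"
proof (rule lborel_product.PiM_eqI[OF orthonormal_basis_finite[OF B]])
  let ?P = "PiM B (\<lambda>_. lborel :: real measure)" and ?t = "\<lambda>z. \<lambda>b\<in>B. z b + a b"
  have t: "?t \<in> measurable ?P ?P"
    by (rule measurable_restrict) simp
  show "sets (distr ?P ?P ?t) = sets ?P" by simp
  fix A :: "real ^ 'n \<Rightarrow> real set" assume A: "\<And>b. b \<in> B \<Longrightarrow> A b \<in> sets lborel"
  have shift: "(\<lambda>x. x + a b) -` A b \<in> sets borel" if "b \<in> B" for b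
    using measurable_sets[of "\<lambda>x. x + a b" borel borel "A b"] A[OF that] by simp
  have emea: "emeasure lborel ((\<lambda>x. x + a b) -` A b) = emeasure lborel (A b)" if "b \<in> B" for b
  proof -
    have "(\<lambda>x. x + a b) = (+) (a b)" by (simp add: fun_eq_iff)
    with A[OF that] show ?thesis
      by (subst (2) lborel_distr_plus[of "a b", symmetric]) (simp add: emeasure_distr)
  qed
  have "emeasure (distr ?P ?P ?t) (Pi\<^sub>E B A) = emeasure ?P (?t -` Pi\<^sub>E B A \<inter> space ?P)"
    using A by (intro emeasure_distr[OF t] sets_PiM_I_finite orthonormal_basis_finite[OF B]) auto
  also have "?t -` Pi\<^sub>E B A \<inter> space ?P = Pi\<^sub>E B (\<lambda>b. (\<lambda>x. x + a b) -` A b)"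
    by (auto simp: space_PiM PiE_def Pi_def)
  also have "emeasure ?P \<dots> = (\<Prod>b\<in>B. emeasure lborel ((\<lambda>x. x + a b) -` A b))"
    using shift by (intro lborel_product.emeasure_PiM orthonormal_basis_finite[OF B]) simp
  also have "\<dots> = (\<Prod>b\<in>B. emeasure lborel (A b))"
    by (intro prod.cong) (auto simp: emea)
  finally show "emeasure (distr ?P ?P ?t) (Pi\<^sub>E B A) = (\<Prod>b\<in>B. emeasure lborel (A b))" .
qed

lemma gauss_product_density:
  "gauss_product B = density (PiM B (\<lambda>_. lborel)) (\<lambda>z. ennreal (\<Prod>b\<in>B. std_normal_density (z b)))"
proof (rule gauss_line.PiM_eqI[symmetric, OF orthonormal_basis_finite[OF B]])
  let ?P = "PiM B (\<lambda>_. lborel :: real measure)"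
  have "sets ?P = sets (gauss_product B)" by (intro sets_PiM_cong) auto
  then show "sets (density ?P (\<lambda>z. ennreal (\<Prod>b\<in>B. std_normal_density (z b)))) = sets (gauss_product B)"
    by simp
  fix A :: "real ^ 'n \<Rightarrow> real set" assume A: "\<And>b. b \<in> B \<Longrightarrow> A b \<in> sets gauss_line"
  have "emeasure (density ?P (\<lambda>z. ennreal (\<Prod>b\<in>B. std_normal_density (z b)))) (Pi\<^sub>E B A)
     = (\<integral>\<^sup>+z. ennreal (\<Prod>b\<in>B. std_normal_density (z b)) * indicator (Pi\<^sub>E B A) z \<partial>?P)"
    using A by (intro emeasure_density sets_PiM_I_finite orthonormal_basis_finite[OF B]) auto
  also have "\<dots> = (\<integral>\<^sup>+z. (\<Prod>b\<in>B. ennreal (std_normal_density (z b)) * indicator (A b) (z b)) \<partial>?P)"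
  proof (rule nn_integral_cong)
    fix z assume "z \<in> space ?P"
    then have "indicator (Pi\<^sub>E B A) z = (\<Prod>b\<in>B. indicator (A b) (z b) :: ennreal)"
      using orthonormal_basis_finite[OF B]
      by (auto simp: space_PiM PiE_def Pi_def indicator_def prod_zero_iff of_bool_def prod.neutral)
    then show "ennreal (\<Prod>b\<in>B. std_normal_density (z b)) * indicator (Pi\<^sub>E B A) z
      = (\<Prod>b\<in>B. ennreal (std_normal_density (z b)) * indicator (A b) (z b))"
      by (simp add: prod.distrib prod_ennreal)
  qed
  also have "\<dots> = (\<Prod>b\<in>B. \<integral>\<^sup>+x. ennreal (std_normal_density x) * indicator (A b) x \<partial>lborel)"
    using A by (intro lborel_product.product_nn_integral_prod orthonormal_basis_finite[OF B]) auto
  also have "\<dots> = (\<Prod>b\<in>B. emeasure gauss_line (A b))"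
    using A by (intro prod.cong) (auto simp: emeasure_density)
  finally show "emeasure (density ?P (\<lambda>z. ennreal (\<Prod>b\<in>B. std_normal_density (z b)))) (Pi\<^sub>E B A)
     = (\<Prod>b\<in>B. emeasure gauss_line (A b))" .
qed

text \<open>Rotation invariance of the Gaussian. Lebesgue measure in the coordinates of \<open>B\<close> is translation
  invariant, hence a multiple of Lebesgue measure, and the multiple is 1 because both Gaussians have
  mass 1.\<close>

lemma distr_gauss_product: "distr (gauss_product B) borel (basis_vector B) = gauss_measure"
proof -
  let ?P = "PiM B (\<lambda>_. lborel :: real measure)"
  have bv [measurable]: "basis_vector B \<in> borel_measurable ?P" by (rule measurable_basis_vector[OF B]) simp
  have bvG [measurable]: "basis_vector B \<in> borel_measurable (gauss_product B)" by (rule measurable_basis_vector[OF B]) simp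
  obtain C where C: "\<And>f. f \<in> borel_measurable borel \<Longrightarrow> (\<integral>\<^sup>+z. f (basis_vector B z) \<partial>?P) = C * (\<integral>\<^sup>+x. f x \<partial>lborel)"
  proof (rule translation_invariant_unique[of ?P "basis_vector B"])
    show "sigma_finite_measure ?P" by (rule lborel_product.sigma_finite[OF orthonormal_basis_finite[OF B]])
    fix g :: "real ^ 'n \<Rightarrow> ennreal" and v assume g [measurable]: "g \<in> borel_measurable borel"
    let ?t = "\<lambda>z. \<lambda>b\<in>B. z b + v \<bullet> b"
    have t [measurable]: "?t \<in> measurable ?P ?P" by (rule measurable_restrict) simp
    have "basis_vector B (?t z) = basis_vector B z + v" for z
    proof -
      have "basis_vector B (?t z) = basis_vector B z + basis_vector B (\<lambda>b. v \<bullet> b)"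
        by (simp add: basis_vector_def scaleR_left_distrib sum.distrib)
      then show ?thesis by (simp add: basis_vector_inner[OF B])
    qed
    then have "(\<integral>\<^sup>+z. g (basis_vector B z + v) \<partial>?P) = (\<integral>\<^sup>+z. g (basis_vector B (?t z)) \<partial>?P)" by simp
    also have "\<dots> = (\<integral>\<^sup>+z. g (basis_vector B z) \<partial>distr ?P ?P ?t)"
      by (rule nn_integral_distr[symmetric]) measurable
    finally show "(\<integral>\<^sup>+z. g (basis_vector B z + v) \<partial>?P) = (\<integral>\<^sup>+z. g (basis_vector B z) \<partial>?P)"
      by (simp add: distr_PiM_lborel_translate)
  qed (rule bv, blast)
  have *: "(\<integral>\<^sup>+z. g (basis_vector B z) \<partial>gauss_product B) = C * (\<integral>\<^sup>+x. ennreal (gauss_density x) * g x \<partial>lborel)"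
    if [measurable]: "g \<in> borel_measurable borel" for g
  proof -
    have "(\<integral>\<^sup>+z. g (basis_vector B z) \<partial>gauss_product B)
        = (\<integral>\<^sup>+z. ennreal (gauss_density (basis_vector B z)) * g (basis_vector B z) \<partial>?P)"
      unfolding gauss_product_density gauss_density_basis_vector[OF B, symmetric]
      by (rule nn_integral_density) measurable
    also have "\<dots> = C * (\<integral>\<^sup>+x. ennreal (gauss_density x) * g x \<partial>lborel)"
      by (rule C[of "\<lambda>x. ennreal (gauss_density x) * g x"]) measurable
    finally show ?thesis .
  qed
  have "C = 1"
    using *[of "\<lambda>_. 1"] prob_space.emeasure_space_1[OF prob_space_gauss_product[of B]]
    by (simp add: nn_integral_gauss_density)
  show ?thesis
  proof (rule measure_eqI)
    fix A assume "A \<in> sets (distr (gauss_product B) borel (basis_vector B))"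
    then have A [measurable]: "A \<in> sets borel" by simp
    have "emeasure (distr (gauss_product B) borel (basis_vector B)) A = (\<integral>\<^sup>+x. indicator A x \<partial>distr (gauss_product B) borel (basis_vector B))"
      using A by simp
    also have "\<dots> = (\<integral>\<^sup>+z. indicator A (basis_vector B z) \<partial>gauss_product B)"
      by (rule nn_integral_distr[OF bvG]) simp
    also have "\<dots> = emeasure gauss_measure A"
      using A by (simp add: * \<open>C = 1\<close> gauss_measure_def emeasure_density)
    finally show "emeasure (distr (gauss_product B) borel (basis_vector B)) A = emeasure gauss_measure A" .
  qed (simp add: gauss_measure_def)
qed

end

section \<open>Hausdorff measure on hyperplanes\<close>

lemma hausdorff_outer_translate_le:
  fixes A :: "'a::real_normed_vector set"
  shows "hausdorff_outer k ((+) v ` A) \<le> hausdorff_outer k A"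
  unfolding hausdorff_outer_def
proof (intro SUP_mono bexI INF_greatest)
  fix \<delta> :: real and U :: "nat \<Rightarrow> 'a set"
  assume U: "U \<in> {U. A \<subseteq> (\<Union>i. U i) \<and> (\<forall>i. bounded (U i) \<and> diameter (U i) \<le> \<delta>)}"
  have diam: "diameter ((+) v ` S) = diameter S" for S :: "'a set"
  proof -
    have "(+) v ` S \<times> (+) v ` S = map_prod ((+) v) ((+) v) ` (S \<times> S)" by auto
    then show ?thesis by (simp add: diameter_def image_image case_prod_beta')
  qed
  have weight: "hausdorff_weight k ((+) v ` S) = hausdorff_weight k S" for S :: "'a set"
    by (cases "S = {}") (simp_all add: hausdorff_weight_def diam)
  have "(INF U\<in>{U. (+) v ` A \<subseteq> (\<Union>i. U i) \<and> (\<forall>i. bounded (U i) \<and> diameter (U i) \<le> \<delta>)}.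
      \<Sum>i. hausdorff_weight k (U i)) \<le> (\<Sum>i. hausdorff_weight k ((+) v ` U i))"
  proof (intro INF_lower CollectI conjI allI)
    show "(+) v ` A \<subseteq> (\<Union>i. (+) v ` U i)" using U by blast
  qed (use U in \<open>auto simp: diam bounded_translation\<close>)
  also have "\<dots> = (\<Sum>i. hausdorff_weight k (U i))"
    by (simp only: weight)
  finally show "(INF U\<in>{U. (+) v ` A \<subseteq> (\<Union>i. U i) \<and> (\<forall>i. bounded (U i) \<and> diameter (U i) \<le> \<delta>)}.
      \<Sum>i. hausdorff_weight k (U i)) \<le> (\<Sum>i. hausdorff_weight k (U i))" .
qed auto

lemma hausdorff_outer_translate:
  fixes A :: "'a::real_normed_vector set"
  shows "hausdorff_outer k ((+) v ` A) = hausdorff_outer k A"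
proof (rule antisym)
  have "hausdorff_outer k ((+) (- v) ` (+) v ` A) \<le> hausdorff_outer k ((+) v ` A)"
    by (rule hausdorff_outer_translate_le)
  then show "hausdorff_outer k A \<le> hausdorff_outer k ((+) v ` A)"
    by (simp add: image_image)
qed (rule hausdorff_outer_translate_le)

lemma sets_hausdorff_measure [simp, measurable_cong]: "sets (hausdorff_measure k) = sets borel"
  and space_hausdorff_measure [simp]: "space (hausdorff_measure k) = UNIV"
  unfolding hausdorff_measure_def
  using sets.sigma_sets_eq[of borel] by (auto simp: sets_measure_of_conv space_measure_of_conv)

text \<open>Invariance is inherited from the outer measure, since \<open>measure_of\<close> returns either its restriction
  or the null measure and both are invariant.\<close>

lemma nn_integral_hausdorff_translate:
  fixes g :: "'a::real_normed_vector \<Rightarrow> ennreal"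
  assumes [measurable]: "g \<in> borel_measurable borel"
  shows "(\<integral>\<^sup>+x. g (x + v) \<partial>hausdorff_measure k) = (\<integral>\<^sup>+x. g x \<partial>hausdorff_measure k)"
proof -
  let ?H = "hausdorff_measure k :: 'a measure"
  have t [measurable]: "(\<lambda>x. x + v) \<in> measurable ?H ?H"
    by (simp cong: measurable_cong_sets) (intro borel_measurable_continuous_onI continuous_intros)
  have "distr ?H ?H (\<lambda>x. x + v) = ?H"
  proof (rule measure_eqI)
    fix A assume "A \<in> sets (distr ?H ?H (\<lambda>x. x + v))"
    then have A: "A \<in> sets borel" by simp
    have vimage: "(\<lambda>x. x + v) -` A = (+) (- v) ` A"
      by (auto simp: image_iff) (metis add.commute add_diff_cancel_left' minus_add_cancel uminus_add_conv_diff)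
    have outer: "hausdorff_outer k ((\<lambda>x. x + v) -` A) = hausdorff_outer k A"
      unfolding vimage by (rule hausdorff_outer_translate)
    have B: "(\<lambda>x. x + v) -` A \<in> sets borel"
      using measurable_sets[OF t, of A] A by simp
    have ss: "sigma_sets UNIV (sets borel) = sets (borel :: 'a measure)"
      using sets.sigma_sets_eq[of "borel :: 'a measure"] by simp
    have "emeasure (distr ?H ?H (\<lambda>x. x + v)) A = emeasure ?H ((\<lambda>x. x + v) -` A)"
      using A by (simp add: emeasure_distr[OF t])
    also have "\<dots> = emeasure ?H A"
      unfolding hausdorff_measure_def emeasure_measure_of_conv ss using A B
      by (simp add: outer)
    finally show "emeasure (distr ?H ?H (\<lambda>x. x + v)) A = emeasure ?H A" .
  qed simp
  then have "(\<integral>\<^sup>+x. g x \<partial>?H) = (\<integral>\<^sup>+x. g x \<partial>distr ?H ?H (\<lambda>x. x + v))" by simp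
  also have "\<dots> = (\<integral>\<^sup>+x. g (x + v) \<partial>?H)"
    by (rule nn_integral_distr[OF t]) simp
  finally show ?thesis ..
qed

lemma sigma_finite_measure_if_integral_finite:
  fixes g :: "'a \<Rightarrow> real"
  assumes [measurable]: "g \<in> borel_measurable M" and pos: "\<And>x. x \<in> space M \<Longrightarrow> 0 < g x"
    and fin: "(\<integral>\<^sup>+x. ennreal (g x) \<partial>M) < \<infinity>"
  shows "sigma_finite_measure M"
proof
  let ?A = "\<lambda>n. {x \<in> space M. 1 \<le> of_nat (Suc n) * ennreal (g x)}"
  show "\<exists>A. countable A \<and> A \<subseteq> sets M \<and> \<Union>A = space M \<and> (\<forall>a\<in>A. emeasure M a \<noteq> \<infinity>)"
  proof (intro exI[of _ "range ?A"] conjI ballI)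
    show "\<Union>(range ?A) = space M"
    proof safe
      fix x assume x: "x \<in> space M"
      obtain n where n: "1 / g x < real n" using reals_Archimedean2 by blast
      have "1 \<le> real (Suc n) * g x" using n pos[OF x] by (simp add: field_simps)
      then have "ennreal 1 \<le> ennreal (real (Suc n) * g x)" by (rule ennreal_leI)
      also have "\<dots> = of_nat (Suc n) * ennreal (g x)"
        using pos[OF x] by (simp only: ennreal_mult' of_nat_0_le_iff ennreal_of_nat_eq_real_of_nat)
      finally have "1 \<le> of_nat (Suc n) * ennreal (g x)" by simp
      with x show "x \<in> \<Union>(range ?A)" by blast
    qed
    fix a assume "a \<in> range ?A"
    then obtain n where a: "a = ?A n" by auto
    have "emeasure M (?A n) \<le> of_nat (Suc n) * (\<integral>\<^sup>+x. ennreal (g x) * indicator (space M) x \<partial>M)"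
      by (rule order_trans[OF _ nn_integral_Markov_inequality[of _ "space M"]])
        (auto intro!: emeasure_mono)
    also have "\<dots> < \<infinity>"
      using fin by (simp add: ennreal_mult_less_top ennreal_of_nat_eq_real_of_nat del: of_nat_Suc)
    finally show "emeasure M a \<noteq> \<infinity>" unfolding a by simp
  qed auto
qed

text \<open>The restriction to the hyperplane is written as a density, so that the underlying space and its
  Borel sets stay those of \<open>real ^ 'n\<close>.\<close>

definition hyperplane_measure :: "real ^ 'n \<Rightarrow> (real ^ 'n) measure" where
  "hyperplane_measure \<xi> = density (hausdorff_measure (CARD('n) - 1)) (indicator (orth_hyperplane \<xi>))"

lemma sets_hyperplane_measure [simp, measurable_cong]: "sets (hyperplane_measure \<xi>) = sets borel"
  and space_hyperplane_measure [simp]: "space (hyperplane_measure \<xi>) = UNIV"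
  by (simp_all add: hyperplane_measure_def)

lemma measurable_orth_hyperplane [measurable]: "orth_hyperplane \<xi> \<in> sets borel"
  unfolding orth_hyperplane_def by measurable

lemma nn_integral_hyperplane_measure:
  "g \<in> borel_measurable borel \<Longrightarrow> (\<integral>\<^sup>+x. g x \<partial>hyperplane_measure (\<xi> :: real ^ 'n))
    = (\<integral>\<^sup>+x. indicator (orth_hyperplane \<xi>) x * g x \<partial>hausdorff_measure (CARD('n) - 1))"
  unfolding hyperplane_measure_def by (rule nn_integral_density) auto

lemma nn_integral_hyperplane_translate:
  fixes \<xi> :: "real ^ 'n"
  assumes [measurable]: "g \<in> borel_measurable borel" and v: "v \<in> orth_hyperplane \<xi>"
  shows "(\<integral>\<^sup>+x. g (x + v) \<partial>hyperplane_measure \<xi>) = (\<integral>\<^sup>+x. g x \<partial>hyperplane_measure \<xi>)"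
proof -
  let ?H = "hausdorff_measure (CARD('n) - 1) :: (real ^ 'n) measure"
  have ind: "indicator (orth_hyperplane \<xi>) x = (indicator (orth_hyperplane \<xi>) (x + v) :: ennreal)" for x
    using v by (simp add: orth_hyperplane_def indicator_def inner_add_right)
  have "(\<integral>\<^sup>+x. g (x + v) \<partial>hyperplane_measure \<xi>) = (\<integral>\<^sup>+x. indicator (orth_hyperplane \<xi>) (x + v) * g (x + v) \<partial>?H)"
    by (simp add: nn_integral_hyperplane_measure flip: ind)
  also have "\<dots> = (\<integral>\<^sup>+x. indicator (orth_hyperplane \<xi>) x * g x \<partial>?H)"
    by (rule nn_integral_hausdorff_translate[of "\<lambda>x. indicator (orth_hyperplane \<xi>) x * g x"]) measurable
  also have "\<dots> = (\<integral>\<^sup>+x. g x \<partial>hyperplane_measure \<xi>)"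
    by (simp add: nn_integral_hyperplane_measure)
  finally show ?thesis .
qed

lemma dir_marginal_eq:
  fixes \<xi> :: "real ^ 'n"
  assumes [measurable]: "G \<in> borel_measurable borel"
  shows "dir_marginal G \<xi> t = (\<integral>x. G (x + t *\<^sub>R \<xi>) \<partial>hyperplane_measure \<xi>)"
proof -
  let ?H = "hausdorff_measure (CARD('n) - 1) :: (real ^ 'n) measure"
  have "hyperplane_measure \<xi> = density ?H (\<lambda>x. ennreal (indicator (orth_hyperplane \<xi>) x))"
    unfolding hyperplane_measure_def by (simp add: ennreal_indicator)
  then show ?thesis
    by (simp add: dir_marginal_def set_lebesgue_integral_def integral_density)
qed

text \<open>A positive function whose marginals in direction \<open>\<xi>\<close> are positive cannot have divergent
  hyperplane integrals, since the Bochner integral would then vanish.\<close>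

lemma ennreal_dir_marginal:
  fixes \<xi> :: "real ^ 'n"
  assumes G [measurable]: "G \<in> borel_measurable borel" and G0: "\<And>x. 0 < G x"
    and pos: "0 < dir_marginal G \<xi> t"
  shows "ennreal (dir_marginal G \<xi> t) = (\<integral>\<^sup>+x. ennreal (G (x + t *\<^sub>R \<xi>)) \<partial>hyperplane_measure \<xi>)"
proof -
  have "integrable (hyperplane_measure \<xi>) (\<lambda>x. G (x + t *\<^sub>R \<xi>))"
    using pos not_integrable_integral_eq by (fastforce simp: dir_marginal_eq[OF G])
  then show ?thesis
    using G0 by (simp add: dir_marginal_eq[OF G] nn_integral_eq_integral less_imp_le)
qed

text \<open>Fubini in the direction \<open>\<xi>\<close>. Sigma-finiteness of the Hausdorff measure on the hyperplane follows
  from the finite integral of the positive function \<open>G\<close>. Its normalisation is read off from \<open>G\<close> as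
  well: uniqueness of Haar measure leaves a factor \<open>C\<close>, and the total mass of the marginal of \<open>G\<close>
  equals \<open>C\<close> times the total mass of \<open>G\<close>.\<close>

lemma hyperplane_Fubini:
  fixes \<xi> :: "real ^ 'n"
  assumes \<xi>: "norm \<xi> = 1"
    and G [measurable]: "G \<in> borel_measurable borel" and G0: "\<And>x. 0 < G x"
    and G1: "(\<integral>\<^sup>+x. ennreal (G x) \<partial>lborel) = 1"
    and marginal: "pos_density (dir_marginal G \<xi>)"
    and h [measurable]: "h \<in> borel_measurable borel"
  shows "(\<integral>\<^sup>+t. \<integral>\<^sup>+y. h (y + t *\<^sub>R \<xi>) \<partial>hyperplane_measure \<xi> \<partial>lborel) = (\<integral>\<^sup>+x. h x \<partial>lborel)"
proof -
  let ?K = "hyperplane_measure \<xi>"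
  note marg = ennreal_dir_marginal[OF G G0 pos_density_pos[OF marginal]]
  have "(\<integral>\<^sup>+x. ennreal (G x) \<partial>?K) < \<infinity>"
    using marg[of 0, symmetric] by simp
  then have K: "sigma_finite_measure ?K"
    using G0 by (intro sigma_finite_measure_if_integral_finite[of G]) auto
  interpret K: sigma_finite_measure ?K by (rule K)
  interpret pair_sigma_finite ?K "lborel :: real measure" by standard
  let ?e = "\<lambda>p. fst p + snd p *\<^sub>R \<xi>"
  have e: "?e \<in> borel_measurable (?K \<Otimes>\<^sub>M lborel)" by measurable
  have split: "(\<integral>\<^sup>+p. g (?e p) \<partial>(?K \<Otimes>\<^sub>M lborel)) = (\<integral>\<^sup>+t. \<integral>\<^sup>+y. g (y + t *\<^sub>R \<xi>) \<partial>?K \<partial>lborel)"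
    if [measurable]: "g \<in> borel_measurable borel" for g :: "real ^ 'n \<Rightarrow> ennreal"
    using nn_integral_snd[of "\<lambda>(y, t). g (y + t *\<^sub>R \<xi>)"] by (simp add: case_prod_beta')
  obtain C where C: "\<And>g. g \<in> borel_measurable borel \<Longrightarrow>
      (\<integral>\<^sup>+p. g (?e p) \<partial>(?K \<Otimes>\<^sub>M lborel)) = C * (\<integral>\<^sup>+x. g x \<partial>lborel)"
  proof (rule translation_invariant_unique[OF _ e])
    show "sigma_finite_measure (?K \<Otimes>\<^sub>M (lborel :: real measure))" by (rule sigma_finite_measure_axioms)
    fix g :: "real ^ 'n \<Rightarrow> ennreal" and v assume g [measurable]: "g \<in> borel_measurable borel"
    \<comment> \<open>split the translation into a part along the hyperplane and a part along \<open>\<xi>\<close>\<close>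
    define s where "s = \<xi> \<bullet> v"
    define v' where "v' = v - s *\<^sub>R \<xi>"
    have v': "v' \<in> orth_hyperplane \<xi>"
      using \<xi> by (simp add: v'_def s_def orth_hyperplane_def inner_diff_right norm_eq_1)
    have "(\<integral>\<^sup>+p. g (?e p + v) \<partial>(?K \<Otimes>\<^sub>M lborel)) = (\<integral>\<^sup>+t. \<integral>\<^sup>+y. g (y + t *\<^sub>R \<xi> + v) \<partial>?K \<partial>lborel)"
      by (rule split[of "\<lambda>x. g (x + v)"]) measurable
    also have "\<dots> = (\<integral>\<^sup>+t. \<integral>\<^sup>+y. g ((y + v') + (t + s) *\<^sub>R \<xi>) \<partial>?K \<partial>lborel)"
      by (simp add: v'_def algebra_simps)
    also have "\<dots> = (\<integral>\<^sup>+t. \<integral>\<^sup>+y. g (y + (t + s) *\<^sub>R \<xi>) \<partial>?K \<partial>lborel)"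
      by (intro nn_integral_cong nn_integral_hyperplane_translate[OF _ v']) measurable
    also have "\<dots> = (\<integral>\<^sup>+t. \<integral>\<^sup>+y. g (y + t *\<^sub>R \<xi>) \<partial>?K \<partial>distr lborel borel ((+) s))"
    proof -
      have "(\<lambda>t. \<integral>\<^sup>+y. g (y + t *\<^sub>R \<xi>) \<partial>?K) \<in> borel_measurable borel"
        by (rule K.borel_measurable_nn_integral) measurable
      then show ?thesis by (simp add: nn_integral_distr add.commute)
    qed
    also have "\<dots> = (\<integral>\<^sup>+p. g (?e p) \<partial>(?K \<Otimes>\<^sub>M lborel))"
      by (simp add: lborel_distr_plus split)
    finally show "(\<integral>\<^sup>+p. g (?e p + v) \<partial>(?K \<Otimes>\<^sub>M lborel)) = (\<integral>\<^sup>+p. g (?e p) \<partial>(?K \<Otimes>\<^sub>M lborel))" .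
  qed blast
  have "C = (\<integral>\<^sup>+t. ennreal (dir_marginal G \<xi> t) \<partial>lborel)"
    using C[of "\<lambda>x. ennreal (G x)"] split[of "\<lambda>x. ennreal (G x)"] by (simp add: G1 marg)
  then have "C = 1" by (simp add: pos_density_nn_integral[OF marginal])
  then show ?thesis using C[OF h] split[OF h] by simp
qed

lemma distr_inner_eq_dir_marginal:
  fixes \<xi> :: "real ^ 'n"
  assumes \<xi>: "norm \<xi> = 1"
    and G [measurable]: "G \<in> borel_measurable borel" and G0: "\<And>x. 0 < G x"
    and G1: "(\<integral>\<^sup>+x. ennreal (G x) \<partial>lborel) = 1"
    and marginal: "pos_density (dir_marginal G \<xi>)"
  shows "distr (density lborel (\<lambda>x. ennreal (G x))) borel (\<lambda>x. x \<bullet> \<xi>)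
       = density lborel (\<lambda>t. ennreal (dir_marginal G \<xi> t))"
proof (rule measure_eqI)
  note [measurable] = pos_density_measurable[OF marginal]
  note marg = ennreal_dir_marginal[OF G G0 pos_density_pos[OF marginal]]
  let ?D = "density lborel (\<lambda>x. ennreal (G x))"
  fix A assume "A \<in> sets (distr ?D borel (\<lambda>x. x \<bullet> \<xi>))"
  then have A [measurable]: "A \<in> sets borel" by simp
  have "emeasure (distr ?D borel (\<lambda>x. x \<bullet> \<xi>)) A = (\<integral>\<^sup>+t. indicator A t \<partial>distr ?D borel (\<lambda>x. x \<bullet> \<xi>))"
    by simp
  also have "\<dots> = (\<integral>\<^sup>+x. indicator A (x \<bullet> \<xi>) \<partial>?D)"
    by (rule nn_integral_distr) measurable
  also have "\<dots> = (\<integral>\<^sup>+x. ennreal (G x) * indicator A (x \<bullet> \<xi>) \<partial>lborel)"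
    by (rule nn_integral_density) measurable
  also have "\<dots> = (\<integral>\<^sup>+t. \<integral>\<^sup>+y. ennreal (G (y + t *\<^sub>R \<xi>)) * indicator A ((y + t *\<^sub>R \<xi>) \<bullet> \<xi>)
      \<partial>hyperplane_measure \<xi> \<partial>lborel)"
    by (rule hyperplane_Fubini[OF \<xi> G G0 G1 marginal, symmetric]) measurable
  also have "\<dots> = (\<integral>\<^sup>+t. ennreal (dir_marginal G \<xi> t) * indicator A t \<partial>lborel)"
  proof (rule nn_integral_cong)
    fix t
    have "AE y in hyperplane_measure \<xi>. y \<in> orth_hyperplane \<xi>"
      unfolding hyperplane_measure_def by (subst AE_density) (auto simp: indicator_def)
    then have "(\<integral>\<^sup>+y. ennreal (G (y + t *\<^sub>R \<xi>)) * indicator A ((y + t *\<^sub>R \<xi>) \<bullet> \<xi>) \<partial>hyperplane_measure \<xi>)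
      = (\<integral>\<^sup>+y. ennreal (G (y + t *\<^sub>R \<xi>)) * indicator A t \<partial>hyperplane_measure \<xi>)"
    proof (intro nn_integral_cong_AE, eventually_elim)
      case (elim y)
      then have "(y + t *\<^sub>R \<xi>) \<bullet> \<xi> = t"
        using \<xi> by (simp add: orth_hyperplane_def inner_add_left norm_eq_1 inner_commute[of y \<xi>])
      then show ?case by simp
    qed
    also have "\<dots> = ennreal (dir_marginal G \<xi> t) * indicator A t"
      by (simp add: nn_integral_multc marg)
    finally show "(\<integral>\<^sup>+y. ennreal (G (y + t *\<^sub>R \<xi>)) * indicator A ((y + t *\<^sub>R \<xi>) \<bullet> \<xi>) \<partial>hyperplane_measure \<xi>)
      = ennreal (dir_marginal G \<xi> t) * indicator A t" .
  qed
  also have "\<dots> = emeasure (density lborel (\<lambda>t. ennreal (dir_marginal G \<xi> t))) A"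
    by (rule emeasure_density[symmetric]) auto
  finally show "emeasure (distr ?D borel (\<lambda>x. x \<bullet> \<xi>)) A
    = emeasure (density lborel (\<lambda>t. ennreal (dir_marginal G \<xi> t))) A" .
qed simp

text \<open>By Pythagoras the Gaussian density splits into a factor in \<open>t\<close> and one on the hyperplane. The
  auxiliary density \<open>G\<close> only serves to normalise the Hausdorff measure on the hyperplane.\<close>

lemma dir_marginal_gauss_density:
  fixes \<xi> :: "real ^ 'n" and G :: "real ^ 'n \<Rightarrow> real"
  assumes \<xi>: "norm \<xi> = 1"
    and G: "G \<in> borel_measurable borel" and G0: "\<And>x. 0 < G x"
    and G1: "(\<integral>\<^sup>+x. ennreal (G x) \<partial>lborel) = 1"
    and marginal: "pos_density (dir_marginal G \<xi>)"
  shows "dir_marginal gauss_density \<xi> = std_normal_density"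
proof
  fix t
  let ?K = "hyperplane_measure \<xi>"
  have "AE y in ?K. y \<in> orth_hyperplane \<xi>"
    unfolding hyperplane_measure_def by (subst AE_density) (auto simp: indicator_def)
  then have split: "AE y in ?K. gauss_density (y + t *\<^sub>R \<xi>) = sqrt (2 * pi) * std_normal_density t * gauss_density y" for t
  proof eventually_elim
    case (elim y)
    then have "(norm (y + t *\<^sub>R \<xi>))\<^sup>2 = (norm y)\<^sup>2 + t\<^sup>2"
      unfolding power2_norm_eq_inner using \<xi>
      by (simp add: orth_hyperplane_def inner_add_left inner_add_right inner_commute[of y \<xi>]
          norm_eq_1 power2_eq_square)
    then show ?case
      by (simp add: gauss_density_def std_normal_density_def exp_add[symmetric] field_simps)
  qed
  let ?a = "\<integral>\<^sup>+y. ennreal (gauss_density y) \<partial>?K"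
  have "(\<integral>\<^sup>+t. \<integral>\<^sup>+y. ennreal (gauss_density (y + t *\<^sub>R \<xi>)) \<partial>?K \<partial>lborel)
      = (\<integral>\<^sup>+t. ennreal (std_normal_density t) * (ennreal (sqrt (2 * pi)) * ?a) \<partial>lborel)"
  proof (rule nn_integral_cong)
    fix t
    have "(\<integral>\<^sup>+y. ennreal (gauss_density (y + t *\<^sub>R \<xi>)) \<partial>?K)
        = (\<integral>\<^sup>+y. ennreal (sqrt (2 * pi) * std_normal_density t) * ennreal (gauss_density y) \<partial>?K)"
      using split[of t] by (intro nn_integral_cong_AE) (auto simp: ennreal_mult'[symmetric])
    also have "\<dots> = ennreal (std_normal_density t) * (ennreal (sqrt (2 * pi)) * ?a)"
      by (subst nn_integral_cmult) (auto simp: ennreal_mult' ac_simps)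
    finally show "(\<integral>\<^sup>+y. ennreal (gauss_density (y + t *\<^sub>R \<xi>)) \<partial>?K)
       = ennreal (std_normal_density t) * (ennreal (sqrt (2 * pi)) * ?a)" .
  qed
  also have "\<dots> = ennreal (sqrt (2 * pi)) * ?a"
    by (simp add: nn_integral_multc pos_density_nn_integral[OF pos_density_std_normal])
  finally have a: "ennreal (sqrt (2 * pi)) * ?a = 1"
    using hyperplane_Fubini[OF \<xi> G G0 G1 marginal, of "\<lambda>x. ennreal (gauss_density x)"]
    by (simp add: nn_integral_gauss_density)
  then have "?a \<noteq> \<infinity>" by (auto simp: ennreal_mult_eq_top_iff)
  then obtain r where r: "?a = ennreal r" "0 \<le> r" by (cases ?a) auto
  have "sqrt (2 * pi) * r = 1"
    using a r by (simp add: ennreal_mult'[symmetric] ennreal_eq_1)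
  moreover have "(\<integral>y. gauss_density y \<partial>?K) = r"
    using r by (subst integral_eq_nn_integral) (auto simp: gauss_density_pos[THEN less_imp_le])
  moreover have "dir_marginal gauss_density \<xi> t
      = (\<integral>y. sqrt (2 * pi) * std_normal_density t * gauss_density y \<partial>?K)"
    unfolding dir_marginal_eq[OF measurable_gauss_density] using split[of t]
    by (intro integral_cong_AE) auto
  ultimately show "dir_marginal gauss_density \<xi> t = std_normal_density t"
    by (simp add: mult.assoc mult.left_commute)
qed

section \<open>From transport maps to the deficit\<close>

lemma sets_gauss_measure [simp, measurable_cong]: "sets gauss_measure = sets borel"
  and space_gauss_measure [simp]: "space gauss_measure = UNIV"
  by (simp_all add: gauss_measure_def)

lemma prob_space_gauss_measure: "prob_space (gauss_measure :: (real ^ 'n) measure)"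
  by (rule prob_spaceI) (simp add: gauss_measure_def emeasure_density nn_integral_gauss_density)

lemma density_gauss_measure:
  fixes f :: "real ^ 'n \<Rightarrow> real"
  assumes "f \<in> borel_measurable borel" "\<And>x. 0 < f x"
  shows "density gauss_measure (\<lambda>x. ennreal (f x)) = density lborel (\<lambda>x. ennreal (f x * gauss_density x))"
  using assms unfolding gauss_measure_def
  by (subst density_density_eq) (auto simp: ennreal_mult'[symmetric] mult.commute gauss_density_pos[THEN less_imp_le])

text \<open>The map of the previous sections in rotated coordinates, with the direction \<open>\<xi>\<close> as the
  first axis.\<close>

lemma transport_bound_gauss_measure:
  fixes f :: "real ^ 'n \<Rightarrow> real" and \<xi> :: "real ^ 'n"
  assumes \<xi>: "norm \<xi> = 1" and f [measurable]: "f \<in> borel_measurable borel" and f0: "\<And>x. 0 < f x"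
    and f1: "(\<integral>\<^sup>+x. ennreal (f x * gauss_density x) \<partial>lborel) = 1"
    and u: "pos_density (dir_marginal (\<lambda>x. f x * gauss_density x) \<xi>)"
  shows "transport_bound gauss_measure (\<lambda>x y. (norm (y - x))\<^sup>2)
    (\<integral>\<^sup>+t. ennreal (2 * log_gap (transport_slope std_normal_density
       (dir_marginal (\<lambda>x. f x * gauss_density x) \<xi>) t)) \<partial>gauss_line) f"
proof -
  let ?G = "\<lambda>x. f x * gauss_density x"
  obtain B where B: "\<xi> \<in> B" "orthonormal_basis B"
    by (rule orthonormal_basis_exists[OF \<xi>])
  let ?I = "B - {\<xi>}" and ?M = "gauss_product B"
  have ins: "insert \<xi> ?I = B" using B by auto
  have fin: "finite B" by (rule orthonormal_basis_finite[OF B(2)])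
  have bv [measurable]: "basis_vector B \<in> borel_measurable ?M"
    by (rule measurable_basis_vector) (auto simp: B)
  have fb: "(\<lambda>z. f (basis_vector B z)) \<in> borel_measurable ?M" by measurable
  have law: "distr (density ?M (\<lambda>z. ennreal (f (basis_vector B z)))) borel (\<lambda>z. z \<xi>)
      = density lborel (\<lambda>t. ennreal (dir_marginal ?G \<xi> t))"
  proof -
    have "distr (density ?M (\<lambda>z. ennreal (f (basis_vector B z)))) borel (\<lambda>z. z \<xi>)
        = distr (density ?M (\<lambda>z. ennreal (f (basis_vector B z)))) borel ((\<lambda>x. x \<bullet> \<xi>) \<circ> basis_vector B)"
      by (rule distr_cong) (auto simp: inner_basis_vector[OF B(2,1)])
    also have "\<dots> = distr (distr (density ?M (\<lambda>z. ennreal (f (basis_vector B z)))) borel (basis_vector B)) borel (\<lambda>x. x \<bullet> \<xi>)"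
      by (rule distr_distr[symmetric]) (use bv in simp_all)
    also have "distr (density ?M (\<lambda>z. ennreal (f (basis_vector B z)))) borel (basis_vector B)
        = density (distr ?M borel (basis_vector B)) (\<lambda>x. ennreal (f x))"
      by (rule density_distr[OF _ bv, symmetric]) simp
    also have "\<dots> = density lborel (\<lambda>x. ennreal (?G x))"
      by (simp add: distr_gauss_product[OF B(2)] density_gauss_measure f0)
    also have "distr \<dots> borel (\<lambda>x. x \<bullet> \<xi>) = density lborel (\<lambda>t. ennreal (dir_marginal ?G \<xi> t))"
      by (intro distr_inner_eq_dir_marginal \<xi> f1 u mult_pos_pos f0 gauss_density_pos) simp
    finally show ?thesis .
  qed
  have *: "transport_bound (gauss_product (insert \<xi> ?I)) (\<lambda>x y. \<Sum>b\<in>insert \<xi> ?I. (y b - x b)\<^sup>2)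
    (\<integral>\<^sup>+t. ennreal (2 * log_gap (transport_slope std_normal_density (dir_marginal ?G \<xi>) t)) \<partial>gauss_line)
    (\<lambda>z. f (basis_vector B z))"
    by (rule transport_bound_gauss_product[OF u]) (use fin fb f0 law in \<open>simp_all add: ins insert_absorb B\<close>)
  show ?thesis
  proof (rule transport_bound_iso[where e = "basis_vector B" and M = ?M and f = f])
    show "transport_bound ?M (\<lambda>x y. \<Sum>b\<in>B. (y b - x b)\<^sup>2)
      (\<integral>\<^sup>+t. ennreal (2 * log_gap (transport_slope std_normal_density (dir_marginal ?G \<xi>) t)) \<partial>gauss_line)
      (\<lambda>z. f (basis_vector B z))"
      using * unfolding ins .
    show "basis_vector B \<in> measurable ?M gauss_measure"
      using bv by (simp cong: measurable_cong_sets)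
    show "(\<lambda>x. \<lambda>b\<in>B. x \<bullet> b) \<in> measurable gauss_measure ?M"
      by (rule measurable_restrict) simp
    show "(\<lambda>b\<in>B. basis_vector B z \<bullet> b) = z" if "z \<in> space ?M" for z
      using that by (auto simp: space_PiM PiE_def extensional_def fun_eq_iff inner_basis_vector[OF B(2)] restrict_def)
    have "distr ?M gauss_measure (basis_vector B) = distr ?M borel (basis_vector B)"
      by (rule distr_cong) auto
    then show "distr ?M gauss_measure (basis_vector B) = gauss_measure"
      by (simp add: distr_gauss_product[OF B(2)])
    show "(norm (basis_vector B y - basis_vector B x))\<^sup>2 = (\<Sum>b\<in>B. (y b - x b)\<^sup>2)" for x y
      by (rule norm_basis_vector_diff[OF B(2)])
  qed (simp_all add: case_prod_beta')
qed

text \<open>A transport map induces the coupling given by the law of \<open>(S x, x)\<close>.\<close>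

lemma wasserstein2_le_transport_cost:
  fixes S :: "real ^ 'n \<Rightarrow> real ^ 'n"
  assumes [measurable]: "S \<in> borel_measurable borel" and push: "distr M borel S = N" and M: "sets M = sets borel"
  shows "wasserstein2 N M \<le> ennreal_sqrt (\<integral>\<^sup>+x. ennreal ((norm (S x - x))\<^sup>2) \<partial>M)"
proof -
  let ?P = "distr M borel (\<lambda>x. (S x, x))"
  note [measurable_cong] = M
  have m [measurable]: "(\<lambda>x. (S x, x)) \<in> measurable M borel"
    by (rule borel_measurable_Pair) (auto cong: measurable_cong_sets simp: M)
  have fst: "fst \<in> measurable borel (borel :: (real ^ 'n) measure)"
    and snd: "snd \<in> measurable borel (borel :: (real ^ 'n) measure)"
    by (intro borel_measurable_continuous_onI continuous_intros)+
  have "distr ?P borel fst = distr M borel (fst \<circ> (\<lambda>x. (S x, x)))"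
    by (rule distr_distr[OF _ m]) (rule fst)
  moreover have "distr ?P borel snd = distr M borel (snd \<circ> (\<lambda>x. (S x, x)))"
    by (rule distr_distr[OF _ m]) (rule snd)
  moreover have "distr M borel (\<lambda>x. x) = M" using M by (simp add: distr_id2)
  ultimately have "?P \<in> couplings N M"
    using push by (simp add: couplings_def comp_def)
  then have W: "wasserstein2 N M \<le> ennreal_sqrt (\<integral>\<^sup>+(x, y). ennreal ((norm (x - y))\<^sup>2) \<partial>?P)"
    unfolding wasserstein2_def by (rule INF_lower)
  have "(\<lambda>(x, y). ennreal ((norm (x - y))\<^sup>2)) \<in> borel_measurable (borel :: ((real ^ 'n) \<times> (real ^ 'n)) measure)"
    unfolding case_prod_beta'
    by (intro measurable_compose[OF _ measurable_ennreal] borel_measurable_continuous_onI continuous_intros)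
  then have "(\<integral>\<^sup>+(x, y). ennreal ((norm (x - y))\<^sup>2) \<partial>?P) = (\<integral>\<^sup>+x. ennreal ((norm (S x - x))\<^sup>2) \<partial>M)"
    by (subst nn_integral_distr[OF m]) simp_all
  with W show ?thesis by simp
qed

text \<open>If the entropy integral exists it agrees with the integral of the nonnegative function
  \<open>entropy_gap\<close>, as \<open>f - 1\<close> has mean zero.\<close>

lemma rel_entropy_density:
  fixes f :: "'a \<Rightarrow> real"
  assumes M: "prob_space M" and f [measurable]: "f \<in> borel_measurable M" and f0: "\<And>x. 0 < f x"
    and f1: "(\<integral>\<^sup>+x. ennreal (f x) \<partial>M) = 1"
    and fin: "rel_entropy (density M (\<lambda>x. ennreal (f x))) M \<noteq> \<infinity>"
  obtains e where "0 \<le> e" "rel_entropy (density M (\<lambda>x. ennreal (f x))) M = ereal e"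
    "(\<integral>\<^sup>+x. ennreal (entropy_gap (f x)) \<partial>M) = ennreal e"
proof -
  interpret prob_space M by (rule M)
  let ?N = "density M (\<lambda>x. ennreal (f x))"
  have int: "integrable ?N (entropy_density (exp 1) M ?N)"
    and eq: "rel_entropy ?N M = ereal (KL_divergence (exp 1) M ?N)"
    using fin by (auto simp: rel_entropy_def split: if_splits)
  have "AE x in M. ennreal (f x) = RN_deriv M ?N x"
    by (intro RN_deriv_unique) auto
  then have RN: "AE x in M. entropy_density (exp 1) M ?N x = ln (f x)"
  proof eventually_elim
    case (elim x)
    then show ?case using f0[of x] by (simp add: entropy_density_def log_def less_imp_le flip: elim)
  qed
  have "integrable M (\<lambda>x. f x * entropy_density (exp 1) M ?N x)"
    using int f0 by (subst (asm) integrable_density) (auto simp: less_imp_le)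
  then have int_ent: "integrable M (\<lambda>x. f x * ln (f x))"
    by (rule integrable_cong_AE[THEN iffD1, rotated -1])
      (use RN measurable_entropy_density in \<open>auto elim!: eventually_mono\<close>)
  have int_f: "integrable M f" and f_1: "expectation f = 1"
    using f1 f0 by (auto intro!: integrableI_nonneg simp: integral_eq_nn_integral less_imp_le)
  have int_gap: "integrable M (\<lambda>x. entropy_gap (f x))"
    unfolding entropy_gap_def using int_ent int_f by auto
  have "KL_divergence (exp 1) M ?N = expectation (\<lambda>x. f x * ln (f x))"
    using f0 by (subst KL_density) (auto simp: log_def less_imp_le)
  also have "\<dots> = expectation (\<lambda>x. entropy_gap (f x))"
    unfolding entropy_gap_def using int_ent int_f f_1 prob_space by simp
  finally have KL: "KL_divergence (exp 1) M ?N = expectation (\<lambda>x. entropy_gap (f x))" .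
  show ?thesis
  proof
    show "0 \<le> expectation (\<lambda>x. entropy_gap (f x))"
      using f0 by (intro Bochner_Integration.integral_nonneg entropy_gap_nonneg)
    show "rel_entropy ?N M = ereal (expectation (\<lambda>x. entropy_gap (f x)))"
      using eq KL by simp
    show "(\<integral>\<^sup>+x. ennreal (entropy_gap (f x)) \<partial>M) = ennreal (expectation (\<lambda>x. entropy_gap (f x)))"
      using nn_integral_eq_integral[OF int_gap] entropy_gap_nonneg[OF f0] by simp
  qed
qed

theorem theorem3p1:
  fixes f :: "real ^ 'n \<Rightarrow> real" and \<nu> :: "(real ^ 'n) measure"
  assumes "prob_space \<nu>"
    and "\<nu> = density gauss_measure (\<lambda>x. ennreal (f x))"
    and "continuous_on UNIV f"
    and "\<And>x. 0 < f x"
    and "(\<lambda>x. f x * gauss_density x) \<in> class_Bn"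
  shows "2 * rel_entropy \<nu> gauss_measure - (enn2ereal (wasserstein2 \<nu> gauss_measure))\<^sup>2
         \<ge> ereal (1 / 2 * (distn (\<lambda>x. f x * gauss_density x) gauss_density)\<^sup>2)"
proof (cases "rel_entropy \<nu> gauss_measure = \<infinity>")
  case False
  let ?G = "\<lambda>x. f x * gauss_density x" and ?\<gamma> = "gauss_measure :: (real ^ 'n) measure"
  have f [measurable]: "f \<in> borel_measurable borel"
    by (rule borel_measurable_continuous_onI[OF assms(3)])
  have G0: "0 < ?G x" for x by (intro mult_pos_pos assms(4) gauss_density_pos)
  have "emeasure \<nu> (space \<nu>) = 1" by (rule prob_space.emeasure_space_1[OF assms(1)])
  then have f1: "(\<integral>\<^sup>+x. ennreal (f x) \<partial>?\<gamma>) = 1"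
    by (simp add: assms(2) emeasure_density)
  have G1: "(\<integral>\<^sup>+x. ennreal (?G x) \<partial>lborel) = 1"
    using \<open>emeasure \<nu> (space \<nu>) = 1\<close> assms(4)
    by (simp add: assms(2) density_gauss_measure emeasure_density)
  obtain e where e: "0 \<le> e" "rel_entropy \<nu> ?\<gamma> = ereal e"
    "(\<integral>\<^sup>+x. ennreal (entropy_gap (f x)) \<partial>?\<gamma>) = ennreal e"
    using rel_entropy_density[of ?\<gamma> f] prob_space_gauss_measure f1 assms(2,4) False by auto
  have main: "\<exists>w\<ge>0. wasserstein2 \<nu> ?\<gamma> \<le> ennreal w
      \<and> w\<^sup>2 + (dist1 (dir_marginal ?G \<xi>) (dir_marginal gauss_density \<xi>))\<^sup>2 \<le> 2 * e"
    and dist1_nonneg: "0 \<le> dist1 (dir_marginal ?G \<xi>) (dir_marginal gauss_density \<xi>)"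
    if \<xi>: "\<xi> \<in> sphere 0 1" for \<xi> :: "real ^ 'n"
  proof -
    let ?u = "dir_marginal ?G \<xi>"
    have n1: "norm \<xi> = 1" using \<xi> by simp
    have uB: "?u \<in> class_B" using assms(5) \<xi> by (auto simp: class_Bn_def)
    note u = class_B_pos_density[OF uB]
    have marg: "dir_marginal gauss_density \<xi> = std_normal_density"
      using G0 by (intro dir_marginal_gauss_density[OF n1 _ _ G1 u]) auto
    show "0 \<le> dist1 ?u (dir_marginal gauss_density \<xi>)"
      unfolding marg by (rule dist1_std_normal_le[OF uB])
    have "transport_bound ?\<gamma> (\<lambda>x y. (norm (y - x))\<^sup>2)
      (\<integral>\<^sup>+t. ennreal (2 * log_gap (transport_slope std_normal_density ?u t)) \<partial>gauss_line) f"
      by (rule transport_bound_gauss_measure[OF n1 f assms(4) G1 u])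
    then obtain S where S: "S \<in> measurable ?\<gamma> ?\<gamma>" and push: "distr ?\<gamma> ?\<gamma> S = \<nu>"
      and le: "(\<integral>\<^sup>+x. ennreal ((norm (S x - x))\<^sup>2) \<partial>?\<gamma>)
        + (\<integral>\<^sup>+t. ennreal (2 * log_gap (transport_slope std_normal_density ?u t)) \<partial>gauss_line) \<le> 2 * ennreal e"
      using e(3) assms(2) by (auto simp: transport_bound_def)
    let ?c = "\<integral>\<^sup>+x. ennreal ((norm (S x - x))\<^sup>2) \<partial>?\<gamma>"
    have S': "S \<in> borel_measurable borel" using S by (simp cong: measurable_cong_sets)
    have "distr ?\<gamma> borel S = \<nu>" using push by (subst distr_cong[OF refl, of borel ?\<gamma>]) auto
    then have W: "wasserstein2 \<nu> ?\<gamma> \<le> ennreal_sqrt ?c"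
      by (intro wasserstein2_le_transport_cost S') auto
    have c_le: "?c + ennreal ((dist1 ?u std_normal_density)\<^sup>2) \<le> ennreal (2 * e)"
      using order_trans[OF add_left_mono[OF dist1_std_normal_le(1)[OF uB]] le] e(1)
      by (simp add: ennreal_mult)
    then have "?c \<noteq> \<infinity>" by (auto simp: top_unique)
    then obtain c where c: "?c = ennreal c" "0 \<le> c" by (cases ?c) auto
    have "c + (dist1 ?u std_normal_density)\<^sup>2 \<le> 2 * e"
      using c_le c e(1) by (simp flip: ennreal_plus)
    then show "\<exists>w\<ge>0. wasserstein2 \<nu> ?\<gamma> \<le> ennreal w
      \<and> w\<^sup>2 + (dist1 ?u (dir_marginal gauss_density \<xi>))\<^sup>2 \<le> 2 * e"
      using W c by (intro exI[of _ "sqrt c"]) (simp add: ennreal_sqrt_def marg)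
  qed
  have ne: "sphere (0 :: real ^ 'n) 1 \<noteq> {}" by simp
  then obtain \<xi>0 :: "real ^ 'n" where \<xi>0: "\<xi>0 \<in> sphere 0 1" by blast
  obtain w where w: "wasserstein2 \<nu> ?\<gamma> = ennreal w" "0 \<le> w"
    using main[OF \<xi>0] by (cases "wasserstein2 \<nu> ?\<gamma>") (auto simp: top_unique)
  have d_le: "dist1 (dir_marginal ?G \<xi>) (dir_marginal gauss_density \<xi>) \<le> sqrt (2 * e - w\<^sup>2)"
    if \<xi>: "\<xi> \<in> sphere 0 1" for \<xi> :: "real ^ 'n"
  proof -
    obtain w' where w': "0 \<le> w'" "w \<le> w'"
      "w'\<^sup>2 + (dist1 (dir_marginal ?G \<xi>) (dir_marginal gauss_density \<xi>))\<^sup>2 \<le> 2 * e"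
      using main[OF \<xi>] w by auto
    have "w\<^sup>2 \<le> w'\<^sup>2" using w w' by (intro power_mono)
    with w' show ?thesis by (intro real_le_rsqrt) simp
  qed
  have "distn ?G gauss_density \<le> sqrt (2 * e - w\<^sup>2)"
    unfolding distn_def by (rule cSUP_least[OF ne d_le])
  moreover have "0 \<le> distn ?G gauss_density"
    unfolding distn_def
  proof (rule cSUP_upper2[where x = \<xi>0])
    show "bdd_above ((\<lambda>\<xi>. dist1 (dir_marginal ?G \<xi>) (dir_marginal gauss_density \<xi>)) ` sphere 0 1)"
      by (rule bdd_aboveI2[OF d_le])
  qed (rule \<xi>0, rule dist1_nonneg[OF \<xi>0])
  moreover have "0 \<le> 2 * e - w\<^sup>2"
    using d_le[OF \<xi>0] dist1_nonneg[OF \<xi>0] by (meson order_trans real_sqrt_ge_0_iff)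
  \<comment> \<open>this is the claim with constant 1\<close>
  ultimately have "(distn ?G gauss_density)\<^sup>2 \<le> 2 * e - w\<^sup>2"
    using power_mono[of "distn ?G gauss_density" "sqrt (2 * e - w\<^sup>2)" 2] by simp
  then have "1 / 2 * (distn ?G gauss_density)\<^sup>2 \<le> 2 * e - w\<^sup>2"
    using zero_le_power2[of "distn ?G gauss_density"] by linarith
  moreover have "2 * rel_entropy \<nu> ?\<gamma> - (enn2ereal (wasserstein2 \<nu> ?\<gamma>))\<^sup>2 = ereal (2 * e - w\<^sup>2)"
    using w by (simp add: e(2) enn2ereal_ennreal power2_eq_square)
  ultimately show ?thesis by simp
qed simp

end
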